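(* There is a commutative diagram of homomorphisms of topological abelian monoids consisting of: the surjective inverse system $\mathcal{M}_1 \twoheadleftarrow \mathcal{M}_2 \twoheadleftarrow \mathcal{M}_3 \twoheadleftarrow\cdots$ with surjections $\mathcal{M}\twoheadrightarrow\mathcal{M}_n$ (all given by truncation); the surjective inverse system $\mathcal{A}_1 \twoheadleftarrow \mathcal{A}_2 \twoheadleftarrow \mathcal{A}_3 \twoheadleftarrow\cdots$ with surjections $\mathcal{A}\twoheadrightarrow\mathcal{A}_n$ (all given by the restrictions $\rho_n$); and isomorphisms $\mathcal{M}\simeq\mathcal{A}$ and $\mathcal{M}_n\simeq\mathcal{A}_n$ for all $n\ge 1$ (given by $\eta$). Hence $$\varprojlim_{n} \mathcal{A}_n \simeq \mathcal{A} \simeq \mathcal{M} \simeq \varprojlim_{n} \mathcal{M}_n$$ as topological monoids.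
   Context: $\mathbb{N} = \{0,1,2,\dots\}$, $\mathbb{N}_+ = \{1,2,\dots\}$. For $L_1, L_2 \subset \mathbb{Z}^2$, $L_1 + L_2 = \{u+v : u\in L_1, v\in L_2\}$; for $a\in\mathbb{N}$, $aL$ denotes the sum of $a$ copies of $L$, the empty sum being the identity $\mathbb{N}^2$. The monoid $\mathcal{M}$: $\mathcal{M} = \mathbb{N}^{\mathbb{N}_+}$ is the monoid of all sequences of non-negative integers under componentwise addition, with the product topology ($\mathbb{N}$ discrete). $\mathcal{M}_n = \{(a_j)_{j\ge1} \in \mathcal{M} : a_j = 0 \text{ for } j > n\}$, which is discrete. Truncation to $\mathcal{M}_n$ replaces all coordinates with index $>n$ by $0$. The set $\mathcal{A}$: A monoid submodule is a subset $L \subset \mathbb{Z}^2$ with $L + \mathbb{N}^2 \subset L$. It is co-artinian if it contains no infinite strictly descending chain for the componentwise order. It is integrally closed if $L = \operatorname{conv}(L)\cap\mathbb{Z}^2$ (convex hull in $\mathbb{R}^2$). Put $\mathrm{New}(L) = \operatorname{conv}(L)\subset\mathbb{R}^2$. $\mathcal{A}$ is the collection of all $L\subset\mathbb{Z}^2$ such that 1. $L$ is a monoid submodule; 2. $L$ is co-artinian; 3. $L$ is integrally closed; 4. $\mathbb{N}^2 \subset L$, every $(a,b)\in L$ has $a\ge 0$, and $(0,b)\in L$ implies $b \ge 0$; 5. $P=\mathrm{New}(L)$ contains no infinite ray $\{t(a,b) : t\ge 0\}$ with $b<0<a$; 6. $P$ has no infinite facet except the positive $y$-axis and (possibly) an infinite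 ray parallel to the $x$-axis; 7. every finite facet of $P$ is a line segment joining vertices $(c,d)$ and $(c+mk, d-m)$ for some positive integers $k,m$ and integers $d\le 0\le c$; i.e. it has outward normal $(-1,-k)$. For $n\ge1$, $\mathcal{A}_n$ is the set of those $L\in\mathcal{A}$ for which the outward normals of the finite facets of $\mathrm{New}(L)$ all belong to $\{(-1,-k) : 1\le k\le n\}$. The monoid operation on $\mathcal{A}$ and $\mathcal{A}_n$ is addition of subsets of $\mathbb{Z}^2$. Topology: $\mathcal{A}$ has the subspace topology via the embedding $L \mapsto \chi_L=\sum_{\alpha\in L} x^\alpha$ into $\mathbb{Z}^{\mathbb{Z}^2}$ with the product topology, $\mathbb{Z}$ discrete. $\mathcal{A}_n$ has the subspace topology. The map $\eta$: for $j\ge1$ let $F_j = \mathbb{N}^2\cup\big((j,-1)+\mathbb{N}^2\big)$ (the set of exponent vectors of the integral closure of $(x^j,y)\subset\mathbb{C}[x,y]$, translated by $(0,-1)$). The map $\eta:\mathcal{M}\to\mathcal{A}$ is $\eta((a_j)_j)=\sum_{j=1}^\infty a_jF_j$, the limit in $\mathcal{A}$ of the partial sums; it restricts to $\mathcal{M}_n\to\mathcal{A}_n$. The restrictions $\rho_n$: for $M\in\mathcal{A}$ and an integer $c\ge0$ let $M(c) = \{(a,b)\in M : b\ge -c\}$. For $n\ge1$ let $\rho_n(M) = M(c(n))$, where $c(n)$ is the largest $c$ such that $\mathrm{New}(M(c))$ has no boundary segment with outward normal $(-1,-k)$ with $k>n$; if no largest such $c$ exists (i.e. $M\in\mathcal{A}_n$),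 $\rho_n(M)=M$. Then $\rho_n(M)\in\mathcal{A}_n$. *)

theory Defs
  imports "HOL-Analysis.Analysis" "HOL-Algebra.FiniteProduct"
begin

section \<open>Topological commutative monoids and inverse limits\<close>

record 'a top_monoid = "'a monoid" +
  topo :: "'a topology"

locale top_comm_monoid = comm_monoid G for G :: "('a, 'b) top_monoid_scheme" (structure) +
  assumes topspace_topo: "topspace (topo G) = carrier G"
    and continuous_mult:
      "continuous_map (prod_topology (topo G) (topo G)) (topo G) (\<lambda>(x, y). x \<otimes> y)"

text \<open>The library's \<open>hom\<close> (and hence \<open>epi\<close> and \<open>iso\<close>) does not ask that the unit be preserved,
  which has to be required separately for monoids.\<close>

definition top_hom ::
  "('a, 'c) top_monoid_scheme \<Rightarrow> ('b, 'd) top_monoid_scheme \<Rightarrow> ('a \<Rightarrow> 'b) set" where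
  "top_hom G H =
    {f \<in> hom G H. f \<one>\<^bsub>G\<^esub> = \<one>\<^bsub>H\<^esub> \<and> continuous_map (topo G) (topo H) f}"

definition top_epi ::
  "('a, 'c) top_monoid_scheme \<Rightarrow> ('b, 'd) top_monoid_scheme \<Rightarrow> ('a \<Rightarrow> 'b) set" where
  "top_epi G H = {f \<in> top_hom G H. f ` carrier G = carrier H}"

definition top_iso ::
  "('a, 'c) top_monoid_scheme \<Rightarrow> ('b, 'd) top_monoid_scheme \<Rightarrow> ('a \<Rightarrow> 'b) set" where
  "top_iso G H =
    {f \<in> top_hom G H. bij_betw f (carrier G) (carrier H) \<and> homeomorphic_map (topo G) (topo H) f}"

text \<open>Inverse systems are indexed by \<open>n \<ge> 1\<close>, and \<open>p n\<close> is the transition map from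
  \<open>G (n + 1)\<close> to \<open>G n\<close>.\<close>

definition surjective_inverse_system :: "(nat \<Rightarrow> 'a top_monoid) \<Rightarrow> (nat \<Rightarrow> 'a \<Rightarrow> 'a) \<Rightarrow> bool" where
  "surjective_inverse_system G p \<longleftrightarrow>
    (\<forall>n\<ge>1. top_comm_monoid (G n) \<and> p n \<in> top_epi (G (Suc n)) (G n))"

definition inverse_limit_carrier ::
  "(nat \<Rightarrow> 'a top_monoid) \<Rightarrow> (nat \<Rightarrow> 'a \<Rightarrow> 'a) \<Rightarrow> (nat \<Rightarrow> 'a) set" where
  "inverse_limit_carrier G p =
    {x \<in> (\<Pi>\<^sub>E n\<in>{1..}. carrier (G n)). \<forall>n\<ge>1. p n (x (Suc n)) = x n}"

definition inverse_limit ::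
  "(nat \<Rightarrow> 'a top_monoid) \<Rightarrow> (nat \<Rightarrow> 'a \<Rightarrow> 'a) \<Rightarrow> (nat \<Rightarrow> 'a) top_monoid" where
  "inverse_limit G p =
    \<lparr>carrier = inverse_limit_carrier G p,
     mult = (\<lambda>x y. \<lambda>n\<in>{1..}. x n \<otimes>\<^bsub>G n\<^esub> y n),
     one = (\<lambda>n\<in>{1..}. \<one>\<^bsub>G n\<^esub>),
     topo = subtopology (product_topology (\<lambda>n. topo (G n)) {1..}) (inverse_limit_carrier G p)\<rparr>"


section \<open>The monoid of sequences\<close>

text \<open>Sequences indexed by the positive integers are functions on \<^typ>\<open>nat\<close> that are
  extensional on \<open>{1..}\<close>, as required by \<^const>\<open>product_topology\<close>.\<close>

definition seq_monoid :: "(nat \<Rightarrow> nat) top_monoid" where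
  "seq_monoid =
    \<lparr>carrier = (\<Pi>\<^sub>E j\<in>{1..}. UNIV),
     mult = (\<lambda>a b. \<lambda>j\<in>{1..}. a j + b j),
     one = (\<lambda>j\<in>{1..}. 0),
     topo = product_topology (\<lambda>j. discrete_topology UNIV) {1..}\<rparr>"

definition seq_monoid_upto :: "nat \<Rightarrow> (nat \<Rightarrow> nat) top_monoid" where
  "seq_monoid_upto n =
    (let S = {a \<in> carrier seq_monoid. \<forall>j>n. a j = 0}
     in seq_monoid\<lparr>carrier := S, topo := subtopology (topo seq_monoid) S\<rparr>)"

definition truncation :: "nat \<Rightarrow> (nat \<Rightarrow> nat) \<Rightarrow> (nat \<Rightarrow> nat)" where
  "truncation n a = (\<lambda>j\<in>{1..}. if j \<le> n then a j else 0)"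


section \<open>The monoid of lattice sets\<close>

text \<open>Sums of subsets of \<open>\<int>\<^sup>2\<close> are those of \<^theory>\<open>HOL-Library.Set_Algebras\<close>, and
  \<open><\<close> on pairs is the strict part of the componentwise order of
  \<^theory>\<open>HOL-Library.Product_Order\<close>.\<close>

definition quadrant :: "(int \<times> int) set" where
  "quadrant = {(a, b). 0 \<le> a \<and> 0 \<le> b}"

definition monoid_submodule :: "(int \<times> int) set \<Rightarrow> bool" where
  "monoid_submodule L \<longleftrightarrow> L + quadrant \<subseteq> L"

definition co_artinian :: "(int \<times> int) set \<Rightarrow> bool" where
  "co_artinian L \<longleftrightarrow> \<not> (\<exists>u :: nat \<Rightarrow> int \<times> int. \<forall>i. u i \<in> L \<and> u (Suc i) < u i)"

definition real_point :: "int \<times> int \<Rightarrow> real \<times> real" where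
  "real_point = (\<lambda>(a, b). (real_of_int a, real_of_int b))"

definition New :: "(int \<times> int) set \<Rightarrow> (real \<times> real) set" where
  "New L = convex hull (real_point ` L)"

definition integrally_closed :: "(int \<times> int) set \<Rightarrow> bool" where
  "integrally_closed L \<longleftrightarrow> L = {u. real_point u \<in> New L}"

definition outward_normal ::
  "(real \<times> real) set \<Rightarrow> (real \<times> real) set \<Rightarrow> real \<times> real \<Rightarrow> bool" where
  "outward_normal P F v \<longleftrightarrow>
    v \<noteq> 0 \<and> (\<exists>r. (\<forall>x\<in>P. v \<bullet> x \<le> r) \<and> (\<forall>x\<in>F. v \<bullet> x = r))"

definition lattice_sets :: "(int \<times> int) set set" where
  "lattice_sets = {L.
    monoid_submodule L \<and>
    co_artinian L \<and>
    integrally_closed L \<and>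
    quadrant \<subseteq> L \<and> (\<forall>(a, b)\<in>L. 0 \<le> a) \<and> (\<forall>b. (0, b) \<in> L \<longrightarrow> 0 \<le> b) \<and>
    \<not> (\<exists>a b :: real. b < 0 \<and> 0 < a \<and> {t *\<^sub>R (a, b) | t. 0 \<le> t} \<subseteq> New L) \<and>
    (\<forall>F. F facet_of New L \<and> \<not> bounded F \<longrightarrow>
      F = {(0, y) | y. 0 \<le> y} \<or> (\<exists>c d. F = {(x, d) | x. c \<le> x})) \<and>
    (\<forall>F. F facet_of New L \<and> bounded F \<longrightarrow>
      (\<exists>(c :: int) (d :: int) (k :: int) (m :: int). 0 < k \<and> 0 < m \<and> d \<le> 0 \<and> 0 \<le> c \<and>
        real_point (c, d) extreme_point_of New L \<and>
        real_point (c + m * k, d - m) extreme_point_of New L \<and>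
        F = closed_segment (real_point (c, d)) (real_point (c + m * k, d - m))))}"

definition lattice_sets_upto :: "nat \<Rightarrow> (int \<times> int) set set" where
  "lattice_sets_upto n = {L \<in> lattice_sets.
    \<forall>F. F facet_of New L \<and> bounded F \<longrightarrow> (\<exists>k\<in>{1..n}. outward_normal (New L) F (-1, - real k))}"

definition lattice_monoid :: "(int \<times> int) set top_monoid" where
  "lattice_monoid =
    \<lparr>carrier = lattice_sets,
     mult = (+),
     one = quadrant,
     topo = pullback_topology lattice_sets (\<lambda>L. indicator L :: int \<times> int \<Rightarrow> int)
       (product_topology (\<lambda>_. discrete_topology UNIV) UNIV)\<rparr>"

definition lattice_monoid_upto :: "nat \<Rightarrow> (int \<times> int) set top_monoid" where
  "lattice_monoid_upto n =
    lattice_monoid\<lparr>carrier := lattice_sets_upto n,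
      topo := subtopology (topo lattice_monoid) (lattice_sets_upto n)\<rparr>"


section \<open>The isomorphism and the restrictions\<close>

definition F_gen :: "nat \<Rightarrow> (int \<times> int) set" where
  "F_gen j = quadrant \<union> ({(int j, -1)} + quadrant)"

text \<open>The library writes monoids multiplicatively: the multiple \<open>a\<^sub>j F\<^sub>j\<close> is a power and
  the finite sum a \<^const>\<open>finprod\<close>; in particular empty sums are \<^const>\<open>quadrant\<close>.\<close>

definition eta_partial :: "(nat \<Rightarrow> nat) \<Rightarrow> nat \<Rightarrow> (int \<times> int) set" where
  "eta_partial a N =
    finprod lattice_monoid (\<lambda>j. F_gen j [^]\<^bsub>lattice_monoid\<^esub> a j) {1..N}"

definition eta :: "(nat \<Rightarrow> nat) \<Rightarrow> (int \<times> int) set" where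
  "eta a = (THE L. limitin (topo lattice_monoid) (eta_partial a) L sequentially)"

definition cut :: "(int \<times> int) set \<Rightarrow> nat \<Rightarrow> (int \<times> int) set" where
  "cut L c = {(a, b) \<in> L. - int c \<le> b}"

definition admissible_cut :: "nat \<Rightarrow> (int \<times> int) set \<Rightarrow> nat \<Rightarrow> bool" where
  "admissible_cut n L c \<longleftrightarrow>
    \<not> (\<exists>F k. F facet_of New (cut L c) \<and> bounded F \<and> n < k \<and>
        outward_normal (New (cut L c)) F (-1, - real k))"

definition rho :: "nat \<Rightarrow> (int \<times> int) set \<Rightarrow> (int \<times> int) set" where
  "rho n L =
    (if \<exists>c. admissible_cut n L c \<and> (\<forall>c'. admissible_cut n L c' \<longrightarrow> c' \<le> c)
     then cut L (GREATEST c. admissible_cut n L c)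
     else L)"

end

theory Submission
  imports Defs
begin

text \<open>
The boundary of the Newton polygon of a set in \<^const>\<open>lattice_sets\<close> runs down from the origin
with edges of direction \<open>(k, -1)\<close>, where \<open>k\<close> increases from edge to edge. Such a polygon is
determined by the heights of these edges, and a sequence \<open>a\<close> prescribes the height \<open>a k\<close>
of the edge of slope \<open>k\<close>. Everything follows once this dictionary is made explicit and is seen to respect
sums and topologies.

The dictionary is written in terms of support functions. The minimum of \<open>x + k y\<close> over the sum of the
\<open>a j\<close> copies of \<open>F\<^sub>j\<close> is \<open>- (\<Sum>j\<in>{1..<k}. a j * (k - j))\<close>, because the minimum over \<open>F\<^sub>j\<close> is
\<open>min 0 (j - k)\<close>. So the candidate for \<open>\<eta>(a)\<close> is the set \<open>slope_set a\<close> of all \<open>(x, y)\<close> satisfying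
\<open>x + k y \<ge> - support a k\<close> for all natural numbers \<open>k\<close>. In this form the bottom of a
polygon of finite depth needs no separate inequality: it is enforced by letting \<open>k\<close> tend to infinity.
Since \<open>support\<close> is additive in \<open>a\<close>, sums of slope sets are contained in slope sets of sums;
the converse distributes the height of a point among the two summands within one edge
(\<open>slope_set_add\<close>).

Slope sets are in \<^const>\<open>lattice_sets\<close> because the half-planes cutting them out are valid for the
convex hull as well, and because a facet is exposed by a linear functional with nonnegative
coefficients: according to the ratio of the coefficients it is the vertical ray, a horizontal ray, or the
edge of an integral slope (\<open>facet_cases\<close>). Conversely, let \<open>L\<close> be in
\<^const>\<open>lattice_sets\<close> and meet the height \<open>-h\<close>. Excluding descending rays makes the left boundary
of \<open>L\<close> superlinear, so some line through two lattice points of \<open>L\<close>, one above the height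
\<open>-h\<close> and one not, supports \<open>L\<close>. The line cuts out a bounded facet, whose slope is integral by
assumption, and integral closure fills in the lattice points of that facet
(\<open>supporting_integer_line\<close>). Hence \<open>L\<close> is the set of all lattice points satisfying its own support
inequalities of integral slope. The support function is convex in \<open>k\<close>, being a maximum of affine
functions, so its second differences are natural numbers, and they form the sequence sought
(\<open>ex_slope_set_of_lattice_set\<close>).

Both topologies are topologies of finite determination: whether \<open>(x, y)\<close> belongs to
\<open>slope_set a\<close> depends only on the \<open>a j\<close> with \<open>j \<le> x\<close> (\<open>slope_set_local\<close>), and the first \<open>n\<close>
entries of \<open>a\<close> can be read off from membership of finitely many points
(\<open>slope_set_determines_seq\<close>). So \<open>slope_set\<close> is an isomorphism of topological monoids. The partial
sums defining \<^const>\<open>eta\<close> are slope sets of truncations of \<open>a\<close>, which converge to \<open>a\<close>, and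
therefore \<^const>\<open>eta\<close> is \<open>slope_set\<close>. Cutting at a height shortens the descent, and the
largest admissible cut, if there is one, is at the total descent of the slopes up to \<open>n\<close>, so \<^const>\<open>rho\<close> corresponds to
\<^const>\<open>truncation\<close> (\<open>rho_slope_set\<close>). All remaining claims hold for sequences by inspection
and are transported along this isomorphism.
\<close>

section \<open>Lattice sets with prescribed slopes\<close>

text \<open>The edges of slope at most \<open>k\<close> together lead from height \<open>0\<close> down to height \<open>- descent a k\<close>.\<close>

definition descent :: "(nat \<Rightarrow> nat) \<Rightarrow> nat \<Rightarrow> nat" where
  "descent a k = (\<Sum>j\<in>{1..k}. a j)"

text \<open>By partial summation this is \<open>\<Sum>j\<in>{1..<k}. a j * (k - j)\<close>, the value at \<open>(-1, -k)\<close> of the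
support function of the polygon. The nested form makes its first differences the numbers
\<open>descent a k\<close>, which is how it is used.\<close>

definition support :: "(nat \<Rightarrow> nat) \<Rightarrow> nat \<Rightarrow> nat" where
  "support a k = (\<Sum>i<k. descent a i)"

definition slope_set :: "(nat \<Rightarrow> nat) \<Rightarrow> (int \<times> int) set" where
  "slope_set a = {(x, y). \<forall>k::nat. 0 \<le> x + int k * y + int (support a k)}"

lemma descent_0 [simp]: "descent a 0 = 0"
  by (simp add: descent_def)

lemma descent_Suc [simp]: "descent a (Suc k) = descent a k + a (Suc k)"
  by (simp add: descent_def)

lemma support_0 [simp]: "support a 0 = 0"
  by (simp add: support_def)

lemma support_Suc [simp]: "support a (Suc k) = support a k + descent a k"
  by (simp add: support_def)

lemma descent_mono: "i \<le> k \<Longrightarrow> descent a i \<le> descent a k"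
  by (induction k rule: dec_induct) auto

lemma descent_cong:
  assumes "\<And>j. 1 \<le> j \<Longrightarrow> j \<le> k \<Longrightarrow> a j = b j"
  shows "descent a k = descent b k"
  using assms by (simp add: descent_def)

lemma support_cong:
  assumes "\<And>i. i < k \<Longrightarrow> descent a i = descent b i"
  shows "support a k = support b k"
  using assms by (simp add: support_def)

lemma descent_restrict [simp]: "descent (restrict a {Suc 0..}) = descent a"
  by (rule ext, rule descent_cong) simp

lemma support_restrict [simp]: "support (restrict a {Suc 0..}) = support a"
  by (rule ext, rule support_cong) simp

lemma slope_set_restrict [simp]: "slope_set (restrict a {Suc 0..}) = slope_set a"
  by (simp add: slope_set_def)

lemma descent_add: "descent (\<lambda>j. a j + b j) k = descent a k + descent b k"
  by (simp add: descent_def sum.distrib)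

lemma support_add: "support (\<lambda>j. a j + b j) k = support a k + support b k"
  by (simp add: support_def descent_add sum.distrib)

lemma support_ge:
  assumes "m \<le> n" "h \<le> descent a m"
  shows "support a m + (n - m) * h \<le> support a n"
  using \<open>m \<le> n\<close>
proof (induction n rule: dec_induct)
  case (step n)
  have "h \<le> descent a n" using assms(2) descent_mono[OF step(1), of a] by simp
  then show ?case using step by (simp add: Suc_diff_le)
qed simp

lemma support_le:
  assumes "m \<le> n" "\<And>i. i < n \<Longrightarrow> descent a i \<le> h"
  shows "support a n \<le> support a m + (n - m) * h"
  using assms
proof (induction n rule: dec_induct)
  case (step l)
  have "descent a l \<le> h" using step.prems by simp
  moreover have "support a l \<le> support a m + (l - m) * h" using step by simp
  ultimately show ?case using step.hyps by (simp add: Suc_diff_le)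
qed simp

text \<open>As a function of \<open>k\<close>, \<open>support\<close> is convex with slope \<open>descent a i\<close> to the left and
\<open>descent a (Suc i)\<close> to the right of \<open>Suc i\<close>; so every \<open>h\<close> between the two is a subgradient.\<close>

lemma support_tangent:
  assumes "descent a i \<le> h" "h \<le> descent a (Suc i)"
  shows "int (support a (Suc i)) + (int k - int (Suc i)) * int h \<le> int (support a k)"
proof (cases "Suc i \<le> k")
  case True
  have "int (support a (Suc i) + (k - Suc i) * h) \<le> int (support a k)"
    using support_ge[OF True assms(2)] by (simp only: of_nat_le_iff)
  then show ?thesis using True by (simp add: of_nat_diff)
next
  case False
  have "descent a l \<le> h" if "l < Suc i" for l
    using that assms(1) descent_mono[of l i a] by simp
  then have "int (support a (Suc i)) \<le> int (support a k + (Suc i - k) * h)"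
    using support_le[of k "Suc i" a h] False by (simp only: of_nat_le_iff)
  also have "\<dots> = int (support a k) + (int (Suc i) - int k) * int h"
    using False by (simp only: of_nat_add of_nat_mult) (simp add: of_nat_diff)
  finally show ?thesis by (simp add: algebra_simps)
qed

text \<open>At height \<open>-h\<close> within the edge of slope \<open>Suc i\<close>, the inequality of that edge implies all others.\<close>

lemma edge_point_mem:
  assumes "descent a i \<le> h" "h \<le> descent a (Suc i)"
    and "int (Suc i) * int h - int (support a (Suc i)) \<le> x"
  shows "(x, - int h) \<in> slope_set a"
proof -
  have "0 \<le> x + int k * (- int h) + int (support a k)" for k
    using support_tangent[OF assms(1,2), of k] assms(3) by (simp add: algebra_simps)
  then show ?thesis by (simp add: slope_set_def)
qed

text \<open>A point at height \<open>-h\<close> cannot lie below the whole descent: if each \<open>descent a i\<close> with \<open>i \<le> n\<close>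
were at most \<open>h - 1\<close>, the inequality for \<open>k = n + 1\<close> would force \<open>x > n\<close>. The bound on \<open>i\<close> in terms of
\<open>x\<close> is what makes membership depend on finitely many entries of the sequence.\<close>

lemma ex_descent_ge:
  assumes "0 \<le> x - int (Suc n) * int h + int (support a (Suc n))" "x \<le> int n"
  shows "\<exists>i\<le>n. h \<le> descent a i"
proof (rule ccontr)
  assume neg: "\<not> ?thesis"
  then have "descent a i \<le> h - 1" if "i < Suc n" for i
  proof -
    have "\<not> h \<le> descent a i" using neg that by (auto simp: less_Suc_eq_le)
    then show ?thesis by linarith
  qed
  moreover from neg have "0 < h" by fastforce
  ultimately have "support a (Suc n) \<le> Suc n * (h - 1)"
    using support_le[of 0 "Suc n" a "h - 1"] by simp
  then have "int (support a (Suc n)) \<le> int (Suc n) * (int h - 1)"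
    using \<open>0 < h\<close> by (metis One_nat_def Suc_leI int_ops(2) of_nat_diff of_nat_le_iff of_nat_mult)
  then show False using assms by (simp add: algebra_simps)
qed

lemma ex_edge_at_height:
  assumes "0 < h" "h \<le> descent a n"
  shows "\<exists>i<n. descent a i < h \<and> h \<le> descent a (Suc i)"
proof -
  define k where "k = (LEAST k. h \<le> descent a k)"
  have k: "h \<le> descent a k" "k \<le> n"
    unfolding k_def using assms(2) by (auto intro: LeastI Least_le)
  then obtain i where i: "k = Suc i" using assms(1) by (cases k) auto
  have "\<not> h \<le> descent a i" using not_less_Least[of i "\<lambda>k. h \<le> descent a k"] i k_def by auto
  then show ?thesis using k i by (intro exI[of _ i]) auto
qed

text \<open>Each point is in the quadrant or to the right of a definite edge, so that the infinitely many
inequalities reduce to a single one.\<close>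

lemma slope_set_cases:
  assumes "(x, y) \<in> slope_set a"
  obtains "0 \<le> x" "0 \<le> y"
  | i h where "y = - int h" "0 < h" "descent a i < h" "h \<le> descent a (Suc i)"
      "int (Suc i) * int h - int (support a (Suc i)) \<le> x"
proof -
  have mem: "0 \<le> x + int k * y + int (support a k)" for k
    using assms by (simp add: slope_set_def)
  have x: "0 \<le> x" using mem[of 0] by simp
  show ?thesis
  proof (cases "0 \<le> y")
    case True
    with x that(1) show ?thesis by simp
  next
    case False
    define h where "h = nat (- y)"
    have h: "y = - int h" "0 < h" using False by (auto simp: h_def)
    obtain n where n: "h \<le> descent a n"
      using ex_descent_ge[of x "nat x" h a] mem[of "Suc (nat x)"] h x by auto
    obtain i where "descent a i < h" "h \<le> descent a (Suc i)"
      using ex_edge_at_height[OF h(2) n] by auto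
    with that(2)[OF h] show ?thesis using mem[of "Suc i"] h by (simp add: algebra_simps)
  qed
qed

lemma quadrant_subset_slope_set: "quadrant \<subseteq> slope_set a"
  by (auto simp: quadrant_def slope_set_def)

text \<open>The inclusion from left to right is additivity of the support function. For the other one, a point
to the right of the edge of slope \<open>Suc i\<close> of the sum has its height split into two heights,
each within the edge of the same slope of a summand; on these edges the boundary is affine with the
same slope, so the abscissae add up.\<close>

lemma slope_set_add: "slope_set a + slope_set b = slope_set (\<lambda>j. a j + b j)"
proof (intro equalityI subsetI)
  fix u assume "u \<in> slope_set a + slope_set b"
  then obtain p q where pq: "p \<in> slope_set a" "q \<in> slope_set b" "u = p + q"
    by (auto simp: set_plus_def)
  obtain x y x' y' where eq: "p = (x, y)" "q = (x', y')" by fastforce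
  have "0 \<le> (x + x') + int k * (y + y') + int (support a k + support b k)" for k
  proof -
    have "0 \<le> x + int k * y + int (support a k)" "0 \<le> x' + int k * y' + int (support b k)"
      using pq eq by (auto simp: slope_set_def)
    then show ?thesis by (simp add: algebra_simps)
  qed
  then show "u \<in> slope_set (\<lambda>j. a j + b j)"
    using pq eq by (simp add: slope_set_def support_add)
next
  fix u assume u: "u \<in> slope_set (\<lambda>j. a j + b j)"
  obtain x y where eq: "u = (x, y)" by fastforce
  from u[unfolded eq] show "u \<in> slope_set a + slope_set b"
  proof (cases rule: slope_set_cases)
    case 1
    then have "(0, 0) \<in> slope_set a" "(x, y) \<in> slope_set b"
      using quadrant_subset_slope_set by (auto simp: quadrant_def)
    then show ?thesis using eq set_plus_intro by fastforce
  next
    case (2 i h)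
    \<comment> \<open>the first summand takes as much of the height as the second one can do without\<close>
    define h1 where "h1 = min (descent a (Suc i)) (h - descent b i)"
    define h2 where "h2 = h - h1"
    have h1: "descent a i \<le> h1" "h1 \<le> descent a (Suc i)"
      and h2: "descent b i \<le> h2" "h2 \<le> descent b (Suc i)" and h: "h = h1 + h2"
      using 2(3,4) unfolding h1_def h2_def descent_add by auto
    define x1 where "x1 = int (Suc i) * int h1 - int (support a (Suc i))"
    have "(x1, - int h1) \<in> slope_set a"
      using edge_point_mem[OF h1] x1_def by simp
    moreover have "(x - x1, - int h2) \<in> slope_set b"
      using edge_point_mem[OF h2] 2(5) by (simp add: x1_def h support_add descent_add algebra_simps)
    moreover have "u = (x1, - int h1) + (x - x1, - int h2)"
      using 2(1) h eq by simp
    ultimately show ?thesis by (metis set_plus_intro)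
  qed
qed

text \<open>Descending by one unit along an edge of slope \<open>k\<close> moves the boundary to the right by \<open>k\<close>, so
edges of slope greater than \<open>x\<close> concern only points with larger abscissa.\<close>

lemma slope_set_local:
  assumes "\<And>j. 1 \<le> j \<Longrightarrow> j \<le> nat x \<Longrightarrow> a j = b j"
  shows "(x, y) \<in> slope_set a \<longleftrightarrow> (x, y) \<in> slope_set b"
proof -
  have *: "(x, y) \<in> slope_set b" if agree: "\<And>j. 1 \<le> j \<Longrightarrow> j \<le> nat x \<Longrightarrow> a j = b j"
    and mem: "(x, y) \<in> slope_set a" for a b
  proof -
    have desc: "descent a i = descent b i" if "i \<le> nat x" for i
      using that agree by (intro descent_cong) auto
    have supp: "support a k = support b k" if "k \<le> Suc (nat x)" for k
      using that desc by (intro support_cong) auto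
    have ge: "0 \<le> x + int k * y + int (support a k)" for k
      using mem by (simp add: slope_set_def)
    from mem show ?thesis
    proof (cases rule: slope_set_cases)
      case 1
      then show ?thesis using quadrant_subset_slope_set by (auto simp: quadrant_def)
    next
      case (2 i h)
      have x: "0 \<le> x" using ge[of 0] by simp
      obtain n where n: "n \<le> nat x" "h \<le> descent a n"
        using ex_descent_ge[of x "nat x" h a] ge[of "Suc (nat x)"] 2(1) x by auto
      then obtain l where l: "l < n" "descent a l < h" "h \<le> descent a (Suc l)"
        using ex_edge_at_height[OF 2(2)] by blast
      have "descent b l \<le> h" "h \<le> descent b (Suc l)"
        using l n desc[of l] desc[of "Suc l"] by auto
      moreover have "int (Suc l) * int h - int (support b (Suc l)) \<le> x"
        using supp[of "Suc l"] ge[of "Suc l"] l n 2(1) by (simp add: algebra_simps)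
      ultimately show ?thesis using edge_point_mem 2(1) by blast
    qed
  qed
  show ?thesis using *[of a b] *[of b a] assms by metis
qed

text \<open>The lower end of the edge of slope \<open>k\<close>, at height \<open>- descent a k\<close>.\<close>

definition vertex_abscissa :: "(nat \<Rightarrow> nat) \<Rightarrow> nat \<Rightarrow> int" where
  "vertex_abscissa a k = int k * int (descent a k) - int (support a k)"

lemma vertex_mem: "(vertex_abscissa a k, - int (descent a k)) \<in> slope_set a"
  using edge_point_mem[of a k "descent a k"]
  by (simp add: vertex_abscissa_def algebra_simps)

text \<open>Going one step further down in direction \<open>(k, -1)\<close> leaves the set, as the next slope is at least
\<open>k + 1\<close>.\<close>

lemma past_vertex_not_mem:
  "(vertex_abscissa a k + int k, - int (Suc (descent a k))) \<notin> slope_set a"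
proof -
  have "vertex_abscissa a k + int k + int (Suc k) * (- int (Suc (descent a k)))
     + int (support a (Suc k)) < 0"
    by (simp add: vertex_abscissa_def algebra_simps)
  then show ?thesis unfolding slope_set_def by (auto simp only: not_le[symmetric] mem_Collect_eq split)
qed

text \<open>The boundary of \<open>slope_set b\<close> is followed downwards. Suppose that it agrees with that of
\<open>slope_set a\<close> up to slope \<open>j - 1\<close>. If the vertex of \<open>a\<close> at the end of slope \<open>j\<close> belongs to
\<open>slope_set b\<close> then the edge of slope \<open>j\<close> of \<open>b\<close> is long enough to reach it, and if the next
lattice point in the same direction is missing then the edge is not longer.\<close>

lemma slope_set_determines_seq:
  assumes "\<And>k. k \<le> n \<Longrightarrow> (vertex_abscissa a k, - int (descent a k)) \<in> slope_set b"
    and "\<And>k. k \<le> n \<Longrightarrow> (vertex_abscissa a k + int k, - int (Suc (descent a k))) \<notin> slope_set b"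
    and "1 \<le> j" "j \<le> n"
  shows "b j = a j"
  using assms(3,4)
proof (induction j rule: less_induct)
  case (less j)
  obtain i where i: "j = Suc i" using less.prems by (cases j) auto
  have desc: "descent b l = descent a l" if "l \<le> i" for l
    using that less i by (intro descent_cong) auto
  have supp: "support b j = support a j"
    using desc i by (intro support_cong) auto
  have "0 \<le> vertex_abscissa a j + int (Suc j) * (- int (descent a j)) + int (support b (Suc j))"
    using assms(1)[OF less.prems(2)] unfolding slope_set_def by blast
  then have ge: "a j \<le> b j"
    using supp desc[of i] i by (simp add: vertex_abscissa_def algebra_simps)
  have "\<not> a j < b j"
  proof
    assume lt: "a j < b j"
    have "(vertex_abscissa a j + int j, - int (Suc (descent a j))) \<in> slope_set b"
    proof (rule edge_point_mem)
      show "descent b i \<le> Suc (descent a j)" "Suc (descent a j) \<le> descent b (Suc i)"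
        using desc[of i] i lt by auto
      show "int (Suc i) * int (Suc (descent a j)) - int (support b (Suc i))
          \<le> vertex_abscissa a j + int j"
        using supp i by (simp add: vertex_abscissa_def algebra_simps)
    qed
    with assms(2)[OF less.prems(2)] show False by simp
  qed
  with ge show ?case by simp
qed

text \<open>Above height \<open>-c\<close> the two boundaries have the same edges, and \<open>support b k \<le> k c\<close> rules out points
below that height as \<open>k\<close> grows.\<close>

lemma cut_slope_set:
  assumes "\<And>k. descent b k = min (descent a k) c"
  shows "cut (slope_set a) c = slope_set b"
proof (intro equalityI subsetI)
  fix u assume u: "u \<in> cut (slope_set a) c"
  obtain x y where eq: "u = (x, y)" by fastforce
  have mem: "(x, y) \<in> slope_set a" and c: "- int c \<le> y" using u eq by (auto simp: cut_def)
  from mem show "u \<in> slope_set b"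
  proof (cases rule: slope_set_cases)
    case 1
    then show ?thesis using quadrant_subset_slope_set eq by (auto simp: quadrant_def)
  next
    case (2 i h)
    have "support b (Suc i) = support a (Suc i)"
    proof (rule support_cong)
      fix l assume "l < Suc i"
      then have "descent a l < h" using descent_mono[of l i a] 2(3) by simp
      then show "descent b l = descent a l" using assms c 2(1) by simp
    qed
    moreover have "descent b i \<le> h" "h \<le> descent b (Suc i)"
      using assms[of i] assms[of "Suc i"] 2 c by auto
    ultimately show ?thesis using edge_point_mem[of b i h x] 2 eq by simp
  qed
next
  fix u assume u: "u \<in> slope_set b"
  obtain x y where eq: "u = (x, y)" by fastforce
  have mem: "0 \<le> x + int k * y + int (support b k)" for k
    using u eq by (simp add: slope_set_def)
  have "support b k \<le> support a k" for k
    unfolding support_def by (intro sum_mono) (simp add: assms)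
  then have "0 \<le> x + int k * y + int (support a k)" for k
    using mem[of k] by (meson add_left_mono of_nat_le_iff order_trans)
  moreover have "- int c \<le> y"
  proof (rule ccontr)
    assume neg: "\<not> ?thesis"
    define k where "k = Suc (nat x)"
    have "support b k \<le> k * c"
      using support_le[of 0 k b c] assms by simp
    then have "int (support b k) \<le> int k * int c" by (metis of_nat_le_iff of_nat_mult)
    then have "0 \<le> x + int k * (y + int c)" using mem[of k] by (simp add: algebra_simps)
    moreover have "int k * (y + int c) \<le> int k * (-1)"
      using neg by (intro mult_left_mono) auto
    moreover have "0 \<le> x" using mem[of 0] by simp
    ultimately show False by (simp add: k_def)
  qed
  ultimately show "u \<in> cut (slope_set a) c" using eq by (simp add: cut_def slope_set_def)
qed

section \<open>Convex hulls, faces and facets in the plane\<close>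

lemma real_point_Pair [simp]: "real_point (x, y) = (real_of_int x, real_of_int y)"
  by (simp add: real_point_def)

lemma real_point_eq_iff [simp]: "real_point u = real_point v \<longleftrightarrow> u = v"
  by (cases u; cases v) simp

lemma convex_New: "convex (New L)"
  by (simp add: New_def)

lemma real_point_in_New: "u \<in> L \<Longrightarrow> real_point u \<in> New L"
  by (simp add: New_def hull_inc)

lemma New_halfspace:
  assumes "\<And>u. u \<in> L \<Longrightarrow> r \<le> v \<bullet> real_point u" "p \<in> New L"
  shows "r \<le> v \<bullet> p"
proof -
  have "New L \<subseteq> {p. v \<bullet> p \<ge> r}"
    unfolding New_def using assms(1) by (intro hull_minimal convex_halfspace_ge) blast
  with assms(2) show ?thesis by auto
qed

text \<open>On a supporting hyperplane, the convex hull is contained in any convex set \<open>C\<close> that contains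
the points of \<open>L\<close> on the hyperplane, since the open half-space together with the part of \<open>C\<close> on the hyperplane is
convex.\<close>

lemma New_Int_hyperplane_subset:
  assumes supp: "\<And>u. u \<in> L \<Longrightarrow> r \<le> v \<bullet> real_point u"
    and C: "convex C" "\<And>u. u \<in> L \<Longrightarrow> v \<bullet> real_point u = r \<Longrightarrow> real_point u \<in> C"
    and p: "p \<in> New L" "v \<bullet> p = r"
  shows "p \<in> C"
proof -
  let ?D = "{x. r \<le> v \<bullet> x \<and> (v \<bullet> x = r \<longrightarrow> x \<in> C)}"
  have "convex ?D"
  proof (rule convexI)
    fix x y and s t :: real
    assume x: "x \<in> ?D" and y: "y \<in> ?D" and st: "0 \<le> s" "0 \<le> t" "s + t = 1"
    have eq: "v \<bullet> (s *\<^sub>R x + t *\<^sub>R y) - r = s * (v \<bullet> x - r) + t * (v \<bullet> y - r)"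
    proof -
      have "r = (s + t) * r" using st by simp
      then show ?thesis by (simp add: inner_add_right algebra_simps)
    qed
    have nn: "0 \<le> s * (v \<bullet> x - r)" "0 \<le> t * (v \<bullet> y - r)" using x y st by auto
    have "s *\<^sub>R x + t *\<^sub>R y \<in> C" if "v \<bullet> (s *\<^sub>R x + t *\<^sub>R y) = r"
    proof -
      have "s * (v \<bullet> x - r) = 0" "t * (v \<bullet> y - r) = 0" using that eq nn by linarith+
      then consider "s = 0" | "t = 0" | "v \<bullet> x = r" "v \<bullet> y = r" by auto
      then show ?thesis
      proof cases
        case 3
        then show ?thesis using C(1) x y st by (simp add: convexD)
      qed (use \<open>t * _ = 0\<close> \<open>s * _ = 0\<close> x y st in auto)
    qed
    with eq nn show "s *\<^sub>R x + t *\<^sub>R y \<in> ?D" by auto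
  qed
  then have "New L \<subseteq> ?D"
    unfolding New_def using supp C(2) by (intro hull_minimal) auto
  with p show ?thesis by auto
qed

text \<open>A supporting hyperplane at a relative interior point of \<open>F\<close> cuts out a proper face containing
\<open>F\<close>, and for reasons of dimension it is equal to \<open>F\<close>.\<close>

lemma facet_of_imp_exposed:
  fixes P :: "'a::euclidean_space set"
  assumes "convex P" "F facet_of P"
  obtains v r where "v \<noteq> 0" "\<And>p. p \<in> P \<Longrightarrow> r \<le> v \<bullet> p" "F = P \<inter> {p. v \<bullet> p = r}"
proof -
  have F: "F face_of P" "F \<noteq> {}" "F \<noteq> P" "aff_dim F = aff_dim P - 1"
    using assms(2) by (auto simp: facet_of_def)
  have "convex F" using F(1) face_of_imp_convex by blast
  then obtain x where x: "x \<in> rel_interior F" using F(2) rel_interior_eq_empty by blast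
  have "x \<in> F" using x rel_interior_subset by blast
  then have "x \<in> P" "x \<notin> rel_interior P"
    using F face_of_imp_subset face_of_disjoint_rel_interior by blast+
  then obtain v where v: "v \<noteq> 0" "\<And>y. y \<in> P \<Longrightarrow> v \<bullet> x \<le> v \<bullet> y"
      "\<And>y. y \<in> rel_interior P \<Longrightarrow> v \<bullet> x < v \<bullet> y"
    using supporting_hyperplane_rel_boundary[OF assms(1)] by metis
  define E where "E = P \<inter> {p. v \<bullet> p = v \<bullet> x}"
  have E: "E face_of P"
    unfolding E_def using v(2) assms(1) by (intro face_of_Int_supporting_hyperplane_ge) auto
  have "E \<noteq> P"
  proof
    assume "E = P"
    obtain y where y: "y \<in> rel_interior P"
      using \<open>x \<in> P\<close> assms(1) rel_interior_eq_empty by blast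
    then have "y \<in> E" using \<open>E = P\<close> rel_interior_subset by blast
    then show False using v(3)[OF y] by (simp add: E_def)
  qed
  then have dim: "aff_dim E < aff_dim P" using face_of_aff_dim_lt assms(1) E by blast
  have "x \<in> E \<inter> rel_interior F" using x \<open>x \<in> P\<close> by (simp add: E_def)
  then have "F \<subseteq> E"
    using subset_of_face_of[OF E] face_of_imp_subset[OF F(1)] by blast
  then have "F face_of E" using face_of_subset[OF F(1) _ face_of_imp_subset[OF E]] by blast
  have "F = E"
  proof (rule ccontr)
    assume "F \<noteq> E"
    then have "aff_dim F < aff_dim E"
      using face_of_aff_dim_lt \<open>F face_of E\<close> E face_of_imp_convex by blast
    with dim F(4) show False by simp
  qed
  with that v show thesis unfolding E_def by blast
qed

lemma planar_face_is_facet: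
  fixes P :: "(real \<times> real) set"
  assumes "convex P" "E face_of P" "E \<noteq> P" "p \<in> E" "q \<in> E" "p \<noteq> q"
  shows "E facet_of P" "aff_dim P = 2"
proof -
  have "aff_dim {p, q} \<le> aff_dim E" using assms by (intro aff_dim_subset) auto
  then have 1: "1 \<le> aff_dim E" using assms by (simp add: aff_dim_2)
  have 2: "aff_dim E < aff_dim P" using face_of_aff_dim_lt assms by blast
  have 3: "aff_dim P \<le> 2" using aff_dim_le_DIM[of P] by simp
  show "aff_dim P = 2" using 1 2 3 by simp
  show "E facet_of P" using 1 2 3 assms by (auto simp: facet_of_def)
qed


section \<open>The Newton polygon of a slope set\<close>

definition vertex :: "(nat \<Rightarrow> nat) \<Rightarrow> nat \<Rightarrow> int \<times> int" where
  "vertex a k = (vertex_abscissa a k, - int (descent a k))"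

text \<open>This is a single point if \<open>a k = 0\<close>. The definition is meant for \<open>k \<ge> 1\<close>, and is usually
applied to \<open>Suc i\<close>.\<close>

definition edge :: "(nat \<Rightarrow> nat) \<Rightarrow> nat \<Rightarrow> (real \<times> real) set" where
  "edge a k = closed_segment (real_point (vertex a (k - 1))) (real_point (vertex a k))"

lemma slope_set_memD: "(x, y) \<in> slope_set a \<Longrightarrow> 0 \<le> x + int k * y + int (support a k)"
  by (simp add: slope_set_def)

lemma vertex_in_slope_set: "vertex a k \<in> slope_set a"
  by (simp add: vertex_def vertex_mem)

lemma New_slope_set_support:
  assumes "(x, y) \<in> New (slope_set a)"
  shows "0 \<le> x + real k * y + real (support a k)"
proof -
  have "- real (support a k) \<le> (1, real k) \<bullet> (x, y)"
  proof (rule New_halfspace[OF _ assms])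
    fix u assume "u \<in> slope_set a"
    then obtain x y where u: "u = (x, y)" "0 \<le> x + int k * y + int (support a k)"
      by (cases u) (auto simp: slope_set_memD)
    then have "0 \<le> real_of_int (x + int k * y + int (support a k))" by (simp only: of_int_0_le_iff)
    then show "- real (support a k) \<le> (1, real k) \<bullet> real_point u" by (simp add: u(1))
  qed
  then show ?thesis by simp
qed

text \<open>The defining inequalities are valid for the convex hull, and a lattice point satisfies them over the
reals iff it satisfies them over the integers.\<close>

lemma integrally_closed_slope_set: "integrally_closed (slope_set a)"
  unfolding integrally_closed_def
proof (intro equalityI subsetI)
  fix u assume "u \<in> {u. real_point u \<in> New (slope_set a)}"
  moreover obtain x y where u: "u = (x, y)" by fastforce
  ultimately have *: "0 \<le> real_of_int x + real k * real_of_int y + real (support a k)" for k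
    using New_slope_set_support by auto
  have "0 \<le> x + int k * y + int (support a k)" for k
  proof -
    have "0 \<le> real_of_int (x + int k * y + int (support a k))" using *[of k] by simp
    then show ?thesis by (simp only: of_int_0_le_iff)
  qed
  then show "u \<in> slope_set a" by (simp add: slope_set_def u)
qed (simp add: real_point_in_New)

lemma monoid_submodule_slope_set: "monoid_submodule (slope_set a)"
proof -
  have "(x + x', y + y') \<in> slope_set a"
    if "(x, y) \<in> slope_set a" "0 \<le> x'" "0 \<le> y'" for x y x' y'
  proof -
    have "0 \<le> (x + x') + int k * (y + y') + int (support a k)" for k
    proof -
      have "0 \<le> int k * y'" using that by simp
      then show ?thesis using slope_set_memD[OF that(1), of k] that(2) by (simp add: distrib_left)
    qed
    then show ?thesis by (simp add: slope_set_def)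
  qed
  then show ?thesis
    by (fastforce simp: monoid_submodule_def set_plus_def quadrant_def)
qed

text \<open>The inequality for \<open>k = 1\<close> makes \<open>x + y\<close> nonnegative, and it decreases along a
descending chain.\<close>

lemma co_artinian_slope_set: "co_artinian (slope_set a)"
  unfolding co_artinian_def
proof
  assume "\<exists>u::nat \<Rightarrow> int \<times> int. \<forall>i. u i \<in> slope_set a \<and> u (Suc i) < u i"
  then obtain u :: "nat \<Rightarrow> int \<times> int"
    where u: "\<And>i. u i \<in> slope_set a" "\<And>i. u (Suc i) < u i" by blast
  define s where "s i = fst (u i) + snd (u i)" for i
  have nn: "0 \<le> s i" for i
    using slope_set_memD[of "fst (u i)" "snd (u i)" a 1] u(1) by (simp add: s_def)
  have dec: "s (Suc i) < s i" for i
    using u(2)[of i] by (cases "u i"; cases "u (Suc i)") (auto simp: s_def less_prod_def)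
  have "s i \<le> s 0 - int i" for i
  proof (induction i)
    case (Suc i)
    then show ?case using dec[of i] by simp
  qed simp
  from this[of "Suc (nat (s 0))"] nn[of "Suc (nat (s 0))"] nn[of 0] show False by simp
qed

lemma slope_set_left_boundary:
  "(x, y) \<in> slope_set a \<Longrightarrow> 0 \<le> x" "(0, y) \<in> slope_set a \<Longrightarrow> 0 \<le> y"
  using slope_set_memD[of x y a 0] slope_set_memD[of 0 y a 1] by auto

text \<open>A ray of direction \<open>(c, b)\<close> violates the inequality of any slope \<open>k\<close> with \<open>c + k b < 0\<close>.\<close>

lemma no_descending_ray:
  assumes "b < 0" "{t *\<^sub>R (c, b) | t. 0 \<le> t} \<subseteq> New (slope_set a)"
  shows False
proof -
  obtain k where k: "c / (- b) < real k" using reals_Archimedean2 by blast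
  then have neg: "c + real k * b < 0" using assms(1) by (simp add: field_simps)
  obtain t where t: "real (support a k) / - (c + real k * b) < real t"
    using reals_Archimedean2 by blast
  then have "real (support a k) + real t * (c + real k * b) < 0" using neg by (simp add: field_simps)
  moreover have "(real t * c, real t * b) \<in> New (slope_set a)" using assms(2) by fastforce
  ultimately show False
    using New_slope_set_support[of "real t * c" "real t * b" a k] by (simp add: algebra_simps)
qed

lemma vertex_abscissa_nonneg: "0 \<le> vertex_abscissa a k"
  using slope_set_left_boundary(1)[OF vertex_mem] .

lemma vertex_Suc:
  "vertex a (Suc i) = (vertex_abscissa a i + int (a (Suc i)) * int (Suc i),
     - int (descent a i) - int (a (Suc i)))"
  by (simp add: vertex_def vertex_abscissa_def algebra_simps)

lemma edge_Suc_points: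
  "edge a (Suc i) = {(real_of_int (vertex_abscissa a i) + t * real (a (Suc i)) * real (Suc i),
     - real (descent a i) - t * real (a (Suc i))) | t. 0 \<le> t \<and> t \<le> 1}"
  unfolding edge_def vertex_Suc
  by (fastforce simp: closed_segment_def vertex_def algebra_simps)

text \<open>The neighbouring inequalities, of slopes \<open>i\<close> and \<open>i + 2\<close>, confine the lattice points on the line of
slope \<open>i + 1\<close> to heights between the two vertices.\<close>

lemma edge_eq:
  "edge a (Suc i) = New (slope_set a) \<inter> {p. (1, real (Suc i)) \<bullet> p = - real (support a (Suc i))}"
proof (intro equalityI subsetI)
  fix p assume p: "p \<in> edge a (Suc i)"
  have "p \<in> New (slope_set a)"
    using p closed_segment_subset[OF _ _ convex_New] real_point_in_New[OF vertex_in_slope_set]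
    unfolding edge_def by blast
  moreover have "(1, real (Suc i)) \<bullet> p = - real (support a (Suc i))"
    using p unfolding edge_Suc_points by (auto simp: vertex_abscissa_def algebra_simps)
  ultimately show "p \<in> New (slope_set a) \<inter> {p. (1, real (Suc i)) \<bullet> p = - real (support a (Suc i))}"
    by simp
next
  fix p assume p: "p \<in> New (slope_set a) \<inter> {p. (1, real (Suc i)) \<bullet> p = - real (support a (Suc i))}"
  show "p \<in> edge a (Suc i)"
  proof (rule New_Int_hyperplane_subset)
    show "- real (support a (Suc i)) \<le> (1, real (Suc i)) \<bullet> real_point u" if "u \<in> slope_set a" for u
      using New_slope_set_support[of "fst (real_point u)" "snd (real_point u)" a "Suc i"]
        real_point_in_New[OF that] by (cases "real_point u") simp
    show "convex (edge a (Suc i))" by (simp add: edge_def)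
    fix u assume u: "u \<in> slope_set a" "(1, real (Suc i)) \<bullet> real_point u = - real (support a (Suc i))"
    obtain x y where xy: "u = (x, y)" by fastforce
    have "real_of_int (x + int (Suc i) * y + int (support a (Suc i))) = 0"
      using u(2) xy by simp
    then have eq: "x + int (Suc i) * y + int (support a (Suc i)) = 0" by (simp only: of_int_eq_0_iff)
    have ge: "0 \<le> x + int k * y + int (support a k)" for k
      using slope_set_memD u(1) xy by blast
    have y: "- int (descent a i) - int (a (Suc i)) \<le> y" "y \<le> - int (descent a i)"
      using eq ge[of i] ge[of "Suc (Suc i)"] by (simp_all add: algebra_simps)
    have x: "x = vertex_abscissa a i + (- int (descent a i) - y) * int (Suc i)"
      using eq by (simp add: vertex_abscissa_def algebra_simps)
    show "real_point u \<in> edge a (Suc i)"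
    proof (cases "a (Suc i) = 0")
      case True
      then have "u = vertex a i" using y x xy by (simp add: vertex_def)
      then show ?thesis by (simp add: edge_def)
    next
      case False
      define t where "t = (- real (descent a i) - real_of_int y) / real (a (Suc i))"
      have "real_of_int (- int (descent a i) - int (a (Suc i))) \<le> real_of_int y"
         "real_of_int y \<le> real_of_int (- int (descent a i))"
        using y by (simp_all only: of_int_le_iff)
      then have "0 \<le> t" "t \<le> 1" and "t * real (a (Suc i)) = - real (descent a i) - real_of_int y"
        using False by (auto simp: t_def field_simps)
      moreover have "real_of_int x = real_of_int (vertex_abscissa a i)
          + (- real (descent a i) - real_of_int y) * real (Suc i)"
        unfolding x by simp
      ultimately have "real_point u = (real_of_int (vertex_abscissa a i)
          + t * real (a (Suc i)) * real (Suc i), - real (descent a i) - t * real (a (Suc i)))"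
        "0 \<le> t" "t \<le> 1"
        by (simp_all add: xy)
      then show ?thesis unfolding edge_Suc_points by blast
    qed
  qed (use p in auto)
qed

lemma edge_face_of: "edge a (Suc i) face_of New (slope_set a)"
  unfolding edge_eq
proof (intro face_of_Int_supporting_hyperplane_ge convex_New)
  fix p assume "p \<in> New (slope_set a)"
  then show "- real (support a (Suc i)) \<le> (1, real (Suc i)) \<bullet> p"
    using New_slope_set_support[of "fst p" "snd p" a "Suc i"] by (cases p) simp
qed

lemma lattice_point_nonneg_in_New:
  "0 \<le> x \<Longrightarrow> 0 \<le> y \<Longrightarrow> (real_of_int x, real_of_int y) \<in> New (slope_set a)"
  using real_point_in_New[of "(x, y)" "slope_set a"] quadrant_subset_slope_set[of a]
  by (auto simp: quadrant_def)

lemma edge_facet_of: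
  assumes "0 < a (Suc i)"
  shows "edge a (Suc i) facet_of New (slope_set a)"
proof (rule planar_face_is_facet(1)[OF convex_New edge_face_of])
  show "edge a (Suc i) \<noteq> New (slope_set a)"
  proof
    assume "edge a (Suc i) = New (slope_set a)"
    then have "(1, 0) \<in> edge a (Suc i)" using lattice_point_nonneg_in_New[of 1 0 a] by simp
    then show False unfolding edge_eq by simp
  qed
  show "real_point (vertex a i) \<in> edge a (Suc i)" "real_point (vertex a (Suc i)) \<in> edge a (Suc i)"
    by (auto simp: edge_def)
  show "real_point (vertex a i) \<noteq> real_point (vertex a (Suc i))"
    using assms by (simp add: vertex_def)
qed

text \<open>Besides identifying a facet, this provides a proper face of dimension one, whence the
polygon has dimension two.\<close>

lemma vertical_facet:
  "New (slope_set a) \<inter> {p. (1, 0) \<bullet> p = 0} = {(0, y) | y. 0 \<le> y}"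
  "aff_dim (New (slope_set a)) = 2"
proof -
  show eq: "New (slope_set a) \<inter> {p. (1, 0) \<bullet> p = 0} = {(0, y) | y. 0 \<le> y}"
  proof (intro equalityI subsetI)
    fix p assume p: "p \<in> New (slope_set a) \<inter> {p. (1, 0) \<bullet> p = 0}"
    show "p \<in> {(0, y) | y. 0 \<le> y}"
    proof (rule New_Int_hyperplane_subset[where L = "slope_set a" and v = "(1, 0)" and r = 0])
      have "{(0::real, y) | y. (0::real) \<le> y} = {0} \<times> {0..}" by auto
      then show "convex {(0::real, y) | y. (0::real) \<le> y}" by (simp add: convex_Times)
    qed (use p slope_set_left_boundary in auto)
  next
    fix p :: "real \<times> real" assume "p \<in> {(0, y) | y. 0 \<le> y}"
    then obtain y where p: "p = (0, y)" "0 \<le> y" by auto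
    have "(0, y) \<in> New (slope_set a)"
    proof (cases "y = 0")
      case False
      define n where "n = \<lceil>y\<rceil>"
      have n: "y \<le> real_of_int n" "0 < real_of_int n" using p False by (simp_all add: n_def)
      have "(1 - y / real_of_int n) *\<^sub>R (0, 0) + (y / real_of_int n) *\<^sub>R (0, real_of_int n)
          \<in> New (slope_set a)"
        using n p lattice_point_nonneg_in_New[of 0 0 a] lattice_point_nonneg_in_New[of 0 n a]
        by (intro convexD[OF convex_New]) (auto simp: field_simps)
      then show ?thesis using n by simp
    qed (use lattice_point_nonneg_in_New[of 0 0 a] in simp)
    then show "p \<in> New (slope_set a) \<inter> {p. (1, 0) \<bullet> p = 0}" using p by simp
  qed
  have "New (slope_set a) \<inter> {p. (1, 0) \<bullet> p = 0} face_of New (slope_set a)"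
    by (intro face_of_Int_supporting_hyperplane_ge convex_New)
      (use New_slope_set_support[of _ _ a 0] in auto)
  then show "aff_dim (New (slope_set a)) = 2"
  proof (rule planar_face_is_facet(2)[OF convex_New])
    show "New (slope_set a) \<inter> {p. (1, 0) \<bullet> p = 0} \<noteq> New (slope_set a)"
    proof -
      have "(1, 0) \<in> New (slope_set a)" using lattice_point_nonneg_in_New[of 1 0 a] by simp
      moreover have "(1, 0) \<notin> New (slope_set a) \<inter> {p. (1, 0) \<bullet> p = 0}" by simp
      ultimately show ?thesis by blast
    qed
    show "(0, 0) \<in> New (slope_set a) \<inter> {p. (1, 0) \<bullet> p = 0}"
      "(0, 1) \<in> New (slope_set a) \<inter> {p. (1, 0) \<bullet> p = 0}" unfolding eq by auto
  qed simp
qed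

text \<open>The lowest height, if there is one, is attained at a lattice point and is therefore an integer; the
leftmost lattice point at that height is the end of the horizontal ray.\<close>

lemma horizontal_face:
  assumes "\<And>p. p \<in> New (slope_set a) \<Longrightarrow> d \<le> snd p" "New (slope_set a) \<inter> {p. snd p = d} \<noteq> {}"
  shows "\<exists>c. New (slope_set a) \<inter> {p. snd p = d} = {(x, d) | x. c \<le> x}"
proof -
  have snd_eq: "(0, 1) \<bullet> p = snd p" for p :: "real \<times> real" by (cases p) simp
  have low: "d \<le> (0, 1) \<bullet> real_point u" if "u \<in> slope_set a" for u
    using assms(1)[OF real_point_in_New[OF that]] by (simp only: snd_eq)
  have "\<exists>u\<in>slope_set a. (0, 1) \<bullet> real_point u = d"
  proof (rule ccontr)
    assume "\<not> ?thesis"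
    then have "p \<in> {}" if "p \<in> New (slope_set a)" "snd p = d" for p
      using New_Int_hyperplane_subset[OF low, where C = "{}" and p = p] that by (auto simp: snd_eq)
    then show False using assms(2) by auto
  qed
  then obtain x0 y where x0: "(x0, y) \<in> slope_set a" "real_of_int y = d" by (auto simp: snd_eq)
  have mem: "(int (nat x0), y) \<in> slope_set a" using x0 slope_set_left_boundary(1) by fastforce
  define c where "c = (LEAST n. (int n, y) \<in> slope_set a)"
  have c: "(int c, y) \<in> slope_set a" unfolding c_def using mem by (rule LeastI)
  have least: "int c \<le> x" if "(x, y) \<in> slope_set a" for x
  proof -
    have "0 \<le> x" using that slope_set_left_boundary(1) by blast
    then have "c \<le> nat x" unfolding c_def using that by (intro Least_le) simp
    then show ?thesis using \<open>0 \<le> x\<close> by simp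
  qed
  have "New (slope_set a) \<inter> {p. snd p = d} = {(x, d) | x. real c \<le> x}"
  proof (intro equalityI subsetI)
    fix p assume p: "p \<in> New (slope_set a) \<inter> {p. snd p = d}"
    show "p \<in> {(x, d) | x. real c \<le> x}"
    proof (rule New_Int_hyperplane_subset[OF low])
      have "{(x, d) | x. real c \<le> x} = {real c..} \<times> {d}" by auto
      then show "convex {(x, d) | x. real c \<le> x}" by (simp add: convex_Times)
    next
      fix u assume u: "u \<in> slope_set a" "(0, 1) \<bullet> real_point u = d"
      obtain x' y' where xy: "u = (x', y')" by fastforce
      have "y' = y" using u xy x0 by simp
      with least[of x'] u xy x0 have "int c \<le> x'" by simp
      then have "real c \<le> real_of_int x'" by (metis of_int_le_iff of_int_of_nat_eq)
      then show "real_point u \<in> {(x, d) | x. real c \<le> x}" using xy \<open>y' = y\<close> x0 by simp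
    qed (use p snd_eq in auto)
  next
    fix p assume "p \<in> {(x, d) | x. real c \<le> x}"
    then obtain x where p: "p = (x, d)" "real c \<le> x" by auto
    have pc: "(real c, d) \<in> New (slope_set a)" using real_point_in_New[OF c] x0 by simp
    define n where "n = \<lceil>x\<rceil>"
    have n: "x \<le> real_of_int n" by (simp add: n_def)
    have "(n, y) \<in> slope_set a"
    proof -
      have "int c \<le> n" using n p by linarith
      then have "0 \<le> n + int k * y + int (support a k)" for k
        using slope_set_memD[OF c, of k] by linarith
      then show ?thesis by (simp add: slope_set_def)
    qed
    then have pn: "(real_of_int n, d) \<in> New (slope_set a)" using real_point_in_New x0 by fastforce
    have "(x, d) \<in> New (slope_set a)"
    proof (cases "x = real c")
      case False
      then have lt: "real c < x" "real c < real_of_int n" using p n by auto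
      define t where "t = (x - real c) / (real_of_int n - real c)"
      have t: "0 \<le> t" "t \<le> 1" "t * (real_of_int n - real c) = x - real c"
        using lt n by (auto simp: t_def field_simps)
      have "(1 - t) *\<^sub>R (real c, d) + t *\<^sub>R (real_of_int n, d) \<in> New (slope_set a)"
        using t by (intro convexD[OF convex_New pc pn]) auto
      then show ?thesis using t by (simp add: algebra_simps)
    qed (use pc in simp)
    then show "p \<in> New (slope_set a) \<inter> {p. snd p = d}" using p by simp
  qed
  then show ?thesis by blast
qed

text \<open>A facet is exposed by some \<open>(v1, v2)\<close>, which has nonnegative coefficients because the polygon
contains both positive axes. If both are positive and \<open>s = v2 / v1\<close>, then \<open>x + s y\<close> is minimal at the
vertex between the slopes below and above \<open>s\<close>. For \<open>i < s < i + 1\<close>, the functional is a convex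
combination of those of slopes \<open>i\<close> and \<open>i + 1\<close>, and both of them are minimal only at that vertex; so
the face is a point. For integral \<open>s\<close> it is the edge of slope \<open>s\<close>.\<close>

lemma facet_cases:
  assumes "F facet_of New (slope_set a)"
  obtains "F = {(0, y) | y. 0 \<le> y}"
  | c d where "F = {(x, d) | x. c \<le> x}"
  | i where "0 < a (Suc i)" "F = edge a (Suc i)"
proof -
  let ?P = "New (slope_set a)"
  have dimF: "aff_dim F = 1" and neF: "F \<noteq> {}"
    using assms vertical_facet(2) by (auto simp: facet_of_def)
  obtain w r where w: "w \<noteq> 0" "\<And>p. p \<in> ?P \<Longrightarrow> r \<le> w \<bullet> p" "F = ?P \<inter> {p. w \<bullet> p = r}"
    using facet_of_imp_exposed[OF convex_New assms] by metis
  obtain v1 v2 where v: "w = (v1, v2)" by fastforce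
  have supp: "r \<le> v1 * x + v2 * y" if "(x, y) \<in> ?P" for x y using w(2)[OF that] v by simp
  have nonneg: "0 \<le> v" if "\<And>n. r \<le> real n * v" for v
  proof (rule ccontr)
    assume neg: "\<not> 0 \<le> v"
    obtain n where "- r / - v < real n" using reals_Archimedean2 by blast
    then show False using that[of n] neg by (simp add: field_simps)
  qed
  have v12: "0 \<le> v1" "0 \<le> v2"
    using supp lattice_point_nonneg_in_New[of "int n" 0 a for n]
      lattice_point_nonneg_in_New[of 0 "int n" a for n]
    by (force intro!: nonneg simp: mult.commute)+
  have r0: "r \<le> 0" using supp[of 0 0] lattice_point_nonneg_in_New[of 0 0 a] by simp
  obtain x1 y1 where p1: "(x1, y1) \<in> ?P" "v1 * x1 + v2 * y1 = r"
  proof -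
    obtain p where "p \<in> ?P" "w \<bullet> p = r" using neF w(3) by blast
    then show thesis using that[of "fst p" "snd p"] v by (cases p) simp
  qed
  have supports: "0 \<le> x1 + real k * y1 + real (support a k)" for k
    using New_slope_set_support p1(1) by blast
  consider "v2 = 0" "0 < v1" | "v1 = 0" "0 < v2" | "0 < v1" "0 < v2"
  proof -
    have "v1 \<noteq> 0 \<or> v2 \<noteq> 0" using w(1) v by (simp add: zero_prod_def)
    then show ?thesis using v12 that by linarith
  qed
  then show thesis
  proof cases
    case 1
    have "0 \<le> v1 * x1" using supports[of 0] 1 by simp
    then have "r = 0" using r0 p1 1 by simp
    then have "w \<bullet> p = r \<longleftrightarrow> (1, 0) \<bullet> p = 0" for p using v 1 by (cases p) simp
    then have "F = {(0, y) | y. 0 \<le> y}" using w(3) vertical_facet(1)[of a] by simp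
    then show thesis by (rule that(1))
  next
    case 2
    have eq: "F = ?P \<inter> {p. snd p = r / v2}" using w(3) v 2 by (auto simp: field_simps)
    have "r / v2 \<le> snd p" if "p \<in> ?P" for p
      using w(2)[OF that] v 2 by (cases p) (simp add: field_simps)
    then show thesis using horizontal_face[of a "r / v2"] that(2) neF eq by metis
  next
    case 3
    define s where "s = v2 / v1"
    have s: "0 < s" and v2: "v2 = v1 * s" using 3 by (auto simp: s_def)
    define i where "i = nat \<lfloor>s\<rfloor>"
    have i: "real i \<le> s" "s < real i + 1" using s by (auto simp: i_def)
    show thesis
    proof (cases "s = real i")
      case True
      then obtain j where j: "i = Suc j" using s by (cases i) auto
      have "r \<le> v1 * (- real (support a i))"
        using supp[of "real_of_int (vertex_abscissa a i)" "- real (descent a i)"]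
          real_point_in_New[OF vertex_in_slope_set[of a i]] v2 True
        by (simp add: vertex_def vertex_abscissa_def algebra_simps)
      moreover have "v1 * (- real (support a i)) \<le> v1 * (x1 + real i * y1)"
        using supports[of i] 3 by (intro mult_left_mono) auto
      ultimately have "r = v1 * (- real (support a i))"
        using p1 v2 True by (simp add: algebra_simps)
      then have "F = ?P \<inter> {p. (1, real i) \<bullet> p = - real (support a i)}"
      proof -
        assume r: "r = v1 * (- real (support a i))"
        have "w \<bullet> p = r \<longleftrightarrow> (1, real i) \<bullet> p = - real (support a i)" for p
        proof -
          have "w \<bullet> p = v1 * ((1, real i) \<bullet> p)"
            using v v2 True by (cases p) (simp add: algebra_simps)
          moreover have "v1 * ((1, real i) \<bullet> p) = v1 * (- real (support a i))
              \<longleftrightarrow> (1, real i) \<bullet> p = - real (support a i)"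
            using 3 by (subst mult_cancel_left) simp
          ultimately show ?thesis using r by simp
        qed
        then show ?thesis using w(3) by simp
      qed
      then have F: "F = edge a (Suc j)" using edge_eq j by simp
      have "a (Suc j) \<noteq> 0"
      proof
        assume "a (Suc j) = 0"
        then have "F \<subseteq> {real_point (vertex a j)}" unfolding F edge_Suc_points by (auto simp: vertex_def)
        then have "aff_dim F \<le> aff_dim {real_point (vertex a j)}" by (rule aff_dim_subset)
        with dimF show False by simp
      qed
      with F that(3) show thesis by blast
    next
      case False
      define t where "t = s - real i"
      have t: "0 < t" "t < 1" "s = real i + t" using i False by (auto simp: t_def)
      have "p = real_point (vertex a i)" if p: "p \<in> F" for p
      proof -
        obtain x y where xy: "p = (x, y)" by fastforce
        have "(x, y) \<in> ?P" and eqr: "v1 * (x + s * y) = r"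
          using p w(3) v v2 xy by (auto simp: algebra_simps)
        then have "0 \<le> x + real k * y + real (support a k)" for k
          using New_slope_set_support by blast
        from this[of i] this[of "Suc i"]
        have ge: "0 \<le> x + real i * y + real (support a i)"
          "0 \<le> x + real (Suc i) * y + real (support a i) + real (descent a i)" by auto
        have "r \<le> v1 * (real_of_int (vertex_abscissa a i) + s * (- real (descent a i)))"
          using supp[of "real_of_int (vertex_abscissa a i)" "- real (descent a i)"]
            real_point_in_New[OF vertex_in_slope_set[of a i]] v2
          by (simp add: vertex_def algebra_simps)
        then have "x + s * y \<le> real_of_int (vertex_abscissa a i) + s * (- real (descent a i))"
          using eqr 3 by (metis mult_le_cancel_left_pos)
        then have "(1 - t) * (x + real i * y + real (support a i))
            + t * (x + real (Suc i) * y + real (support a i) + real (descent a i)) \<le> 0"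
          using t by (simp add: vertex_abscissa_def algebra_simps)
        moreover have "0 \<le> (1 - t) * (x + real i * y + real (support a i))"
          "0 \<le> t * (x + real (Suc i) * y + real (support a i) + real (descent a i))"
          using t ge by auto
        ultimately have "(1 - t) * (x + real i * y + real (support a i)) = 0"
          "t * (x + real (Suc i) * y + real (support a i) + real (descent a i)) = 0" by linarith+
        then have e: "x + real i * y + real (support a i) = 0"
          "x + real (Suc i) * y + real (support a i) + real (descent a i) = 0" using t by auto
        then have "y = - real (descent a i)" by (simp add: algebra_simps)
        moreover have "x = real_of_int (vertex_abscissa a i)"
          using e(1) calculation by (simp add: vertex_abscissa_def)
        ultimately show ?thesis by (simp add: xy vertex_def)
      qed
      then have "F \<subseteq> {real_point (vertex a i)}" by blast
      then have "aff_dim F \<le> aff_dim {real_point (vertex a i)}" by (rule aff_dim_subset)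
      with dimF show thesis by simp
    qed
  qed
qed

lemma unbounded_axis_rays:
  fixes c d :: real
  shows "\<not> bounded {(0::real, y) | y. (0::real) \<le> y}" "\<not> bounded {(x, d) | x. c \<le> x}"
proof
  assume "bounded {(0::real, y) | y. (0::real) \<le> y}"
  then obtain B where B: "\<And>p. p \<in> {(0::real, y) | y. (0::real) \<le> y} \<Longrightarrow> norm p \<le> B"
    unfolding bounded_iff by (elim exE) (rule that, blast)
  have "norm (0::real, \<bar>B\<bar> + 1) \<le> B" by (rule B) simp
  then show False using norm_snd_le[of "\<bar>B\<bar> + 1" "0::real"] by simp
next
  show "\<not> bounded {(x, d) | x. c \<le> x}"
  proof
    assume "bounded {(x, d) | x. c \<le> x}"
    then obtain B where B: "\<And>p. p \<in> {(x, d) | x. c \<le> x} \<Longrightarrow> norm p \<le> B"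
      unfolding bounded_iff by (elim exE) (rule that, blast)
    have "norm (\<bar>B\<bar> + \<bar>c\<bar> + 1, d) \<le> B" by (rule B) simp
    then show False using norm_fst_le[of "\<bar>B\<bar> + \<bar>c\<bar> + 1" d] by simp
  qed
qed

lemma bounded_facet_iff:
  "F facet_of New (slope_set a) \<and> bounded F \<longleftrightarrow> (\<exists>i. 0 < a (Suc i) \<and> F = edge a (Suc i))"
proof
  assume F: "F facet_of New (slope_set a) \<and> bounded F"
  then have "F facet_of New (slope_set a)" by simp
  then show "\<exists>i. 0 < a (Suc i) \<and> F = edge a (Suc i)"
    using F unbounded_axis_rays by (cases rule: facet_cases) auto
next
  assume "\<exists>i. 0 < a (Suc i) \<and> F = edge a (Suc i)"
  then show "F facet_of New (slope_set a) \<and> bounded F"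
    using edge_facet_of by (metis bounded_closed_segment edge_def)
qed

lemma edge_normal_iff:
  assumes "0 < a (Suc i)"
  shows "outward_normal (New (slope_set a)) (edge a (Suc i)) (-1, - real k) \<longleftrightarrow> k = Suc i"
proof
  assume "outward_normal (New (slope_set a)) (edge a (Suc i)) (-1, - real k)"
  then obtain r where r: "\<And>p. p \<in> edge a (Suc i) \<Longrightarrow> (-1, - real k) \<bullet> p = r"
    by (auto simp: outward_normal_def)
  have "real_point (vertex a i) \<in> edge a (Suc i)" "real_point (vertex a (Suc i)) \<in> edge a (Suc i)"
    by (auto simp: edge_def)
  from this[THEN r] have "(-1, - real k) \<bullet> real_point (vertex a (Suc i))
      = (-1, - real k) \<bullet> real_point (vertex a i)" by simp
  then have "real (a (Suc i)) * real k = real (a (Suc i)) * real (Suc i)"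
    unfolding vertex_Suc by (simp add: vertex_def algebra_simps)
  then have "real k = real (Suc i)" using assms by (metis less_numeral_extra(3) mult_cancel_left of_nat_eq_0_iff)
  then show "k = Suc i" by (simp only: of_nat_eq_iff)
next
  assume k: "k = Suc i"
  have "(-1, - real k) \<bullet> p \<le> real (support a k)" if "p \<in> New (slope_set a)" for p
    using New_slope_set_support[of "fst p" "snd p" a k] that by (cases p) simp
  moreover have "(-1, - real k) \<bullet> p = real (support a k)" if "p \<in> edge a (Suc i)" for p
    using that unfolding edge_eq k by (cases p) (simp add: algebra_simps)
  ultimately show "outward_normal (New (slope_set a)) (edge a (Suc i)) (-1, - real k)"
    unfolding outward_normal_def
    by (intro conjI exI[of _ "real (support a k)"] ballI) (simp_all add: zero_prod_def)
qed

lemma slope_set_in_lattice_sets: "slope_set a \<in> lattice_sets"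
proof -
  have 1: "F = {(0, y) | y. 0 \<le> y} \<or> (\<exists>c d. F = {(x, d) | x. c \<le> x})"
    if "F facet_of New (slope_set a)" "\<not> bounded F" for F
    using that(1) by (cases rule: facet_cases) (use that(1,2) bounded_facet_iff in blast)+
  have 2: "\<exists>(c :: int) (d :: int) (k :: int) (m :: int). 0 < k \<and> 0 < m \<and> d \<le> 0 \<and> 0 \<le> c \<and>
        real_point (c, d) extreme_point_of New (slope_set a) \<and>
        real_point (c + m * k, d - m) extreme_point_of New (slope_set a) \<and>
        F = closed_segment (real_point (c, d)) (real_point (c + m * k, d - m))"
    if F: "F facet_of New (slope_set a)" "bounded F" for F
  proof -
    obtain i where i: "0 < a (Suc i)" "F = edge a (Suc i)" using bounded_facet_iff F by blast
    let ?c = "vertex_abscissa a i" and ?d = "- int (descent a i)"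
      and ?k = "int (Suc i)" and ?m = "int (a (Suc i))"
    have v: "vertex a i = (?c, ?d)" "vertex a (Suc i) = (?c + ?m * ?k, ?d - ?m)"
      by (simp add: vertex_def, simp only: vertex_Suc)
    then have eq: "F = closed_segment (real_point (?c, ?d)) (real_point (?c + ?m * ?k, ?d - ?m))"
      using i(2) by (simp only: edge_def diff_Suc_1)
    have "p extreme_point_of New (slope_set a)"
      if "p = real_point (?c, ?d) \<or> p = real_point (?c + ?m * ?k, ?d - ?m)" for p
    proof -
      have "p extreme_point_of F" unfolding eq extreme_point_of_segment using that .
      then show ?thesis using extreme_point_of_face[OF edge_face_of] i(2) by blast
    qed
    moreover have "0 < ?k" "0 < ?m" "?d \<le> 0" "0 \<le> ?c" using i vertex_abscissa_nonneg by auto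
    ultimately show ?thesis using eq by blast
  qed
  have 3: "\<forall>(x, y)\<in>slope_set a. 0 \<le> x" "\<forall>y. (0, y) \<in> slope_set a \<longrightarrow> 0 \<le> y"
    using slope_set_left_boundary by auto
  have 4: "\<not> (\<exists>c b :: real. b < 0 \<and> 0 < c \<and> {t *\<^sub>R (c, b) | t. 0 \<le> t} \<subseteq> New (slope_set a))"
    using no_descending_ray by blast
  show ?thesis
    unfolding lattice_sets_def mem_Collect_eq
    by (intro conjI monoid_submodule_slope_set co_artinian_slope_set integrally_closed_slope_set
        quadrant_subset_slope_set 3 4 allI impI; (elim conjE)?; (rule 1 2; assumption)?)
qed

lemma all_greater_Suc_iff: "(\<forall>j>n. P j) \<longleftrightarrow> (\<forall>i. n < Suc i \<longrightarrow> P (Suc i))" for n :: nat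
proof (intro iffI allI impI)
  fix j assume "\<forall>i. n < Suc i \<longrightarrow> P (Suc i)" "n < j"
  then show "P j" by (cases j) auto
qed simp

lemma slope_set_in_lattice_sets_upto_iff:
  "slope_set a \<in> lattice_sets_upto n \<longleftrightarrow> (\<forall>j>n. a j = 0)"
proof -
  have "slope_set a \<in> lattice_sets_upto n \<longleftrightarrow>
      (\<forall>i. 0 < a (Suc i) \<longrightarrow> (\<exists>k\<in>{1..n}. outward_normal (New (slope_set a)) (edge a (Suc i)) (-1, - real k)))"
    unfolding lattice_sets_upto_def mem_Collect_eq bounded_facet_iff
    using slope_set_in_lattice_sets[of a] by auto
  also have "\<dots> \<longleftrightarrow> (\<forall>i. 0 < a (Suc i) \<longrightarrow> Suc i \<le> n)"
    using edge_normal_iff by auto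
  also have "\<dots> \<longleftrightarrow> (\<forall>j>n. a j = 0)"
    unfolding all_greater_Suc_iff by (intro iff_allI, auto)
  finally show ?thesis .
qed

text \<open>The outward normals \<open>(-1, -k)\<close> of bounded facets are exactly those with a positive entry at \<open>k\<close>.\<close>

lemma admissible_cut_iff:
  assumes "cut L c = slope_set b"
  shows "admissible_cut n L c \<longleftrightarrow> (\<forall>k>n. b k = 0)"
proof -
  have "admissible_cut n L c \<longleftrightarrow> \<not> (\<exists>F. (F facet_of New (slope_set b) \<and> bounded F) \<and>
      (\<exists>k>n. outward_normal (New (slope_set b)) F (-1, - real k)))"
    unfolding admissible_cut_def assms by simp
  also have "\<dots> \<longleftrightarrow> \<not> (\<exists>i. 0 < b (Suc i) \<and>
      (\<exists>k>n. outward_normal (New (slope_set b)) (edge b (Suc i)) (-1, - real k)))"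
    unfolding bounded_facet_iff by blast
  also have "\<dots> \<longleftrightarrow> (\<forall>i. n < Suc i \<longrightarrow> b (Suc i) = 0)"
    using edge_normal_iff[of b] by auto
  also have "\<dots> \<longleftrightarrow> (\<forall>k>n. b k = 0)"
    unfolding all_greater_Suc_iff ..
  finally show ?thesis .
qed

section \<open>Every lattice set is a slope set\<close>

lemma lattice_setsD:
  assumes "L \<in> lattice_sets"
  shows lattice_sets_nonneg: "(x, y) \<in> L \<Longrightarrow> 0 \<le> x"
    and lattice_sets_axis: "(0, y) \<in> L \<Longrightarrow> 0 \<le> y"
    and lattice_sets_quadrant: "0 \<le> x \<Longrightarrow> 0 \<le> y \<Longrightarrow> (x, y) \<in> L"
    and lattice_sets_upward: "(x, y) \<in> L \<Longrightarrow> x \<le> x' \<Longrightarrow> y \<le> y' \<Longrightarrow> (x', y') \<in> L"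
    and lattice_sets_closed: "real_point u \<in> New L \<Longrightarrow> u \<in> L"
proof -
  have L: "L + quadrant \<subseteq> L" "L = {u. real_point u \<in> New L}" "quadrant \<subseteq> L"
      "\<forall>(a, b)\<in>L. 0 \<le> a" "\<forall>b. (0, b) \<in> L \<longrightarrow> 0 \<le> b"
    using assms unfolding lattice_sets_def monoid_submodule_def integrally_closed_def by blast+
  show "(x, y) \<in> L \<Longrightarrow> 0 \<le> x" "(0, y) \<in> L \<Longrightarrow> 0 \<le> y" using L by auto
  show "0 \<le> x \<Longrightarrow> 0 \<le> y \<Longrightarrow> (x, y) \<in> L" using L(3) by (auto simp: quadrant_def)
  show "real_point u \<in> New L \<Longrightarrow> u \<in> L" using L(2) by blast
  show "(x', y') \<in> L" if "(x, y) \<in> L" "x \<le> x'" "y \<le> y'"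
  proof -
    have "(x, y) + (x' - x, y' - y) \<in> L + quadrant"
      using that by (intro set_plus_intro) (auto simp: quadrant_def)
    then show ?thesis using L(1) by auto
  qed
qed

text \<open>The left boundary is superlinear: if points weakly to the left of the ray of direction \<open>(S, -1)\<close>
occurred at arbitrarily low heights, convexity would put the whole ray into the Newton polygon.\<close>

lemma finite_heights_above_line:
  assumes L: "L \<in> lattice_sets" and S: "0 < S"
  shows "finite {c::nat. \<exists>x \<le> int (S * c). (x, - int c) \<in> L}"
proof -
  have "\<not> (\<exists>a b :: real. b < 0 \<and> 0 < a \<and> {t *\<^sub>R (a, b) | t. 0 \<le> t} \<subseteq> New L)"
    using L unfolding lattice_sets_def by blast
  moreover have "(- 1 :: real) < 0" "0 < real S" using S by simp_all
  ultimately have "\<not> {t *\<^sub>R (real S, - 1) | t. 0 \<le> t} \<subseteq> New L" by blast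
  then obtain t where t: "0 \<le> t" "(t * real S, - t) \<notin> New L" by auto
  have "real c \<le> t" if c: "x \<le> int (S * c)" "(x, - int c) \<in> L" for c x
  proof (rule ccontr)
    assume lt: "\<not> real c \<le> t"
    have "(int (S * c), - int c) \<in> L" using lattice_sets_upward[OF L c(2) c(1)] by simp
    then have 1: "(real S * real c, - real c) \<in> New L" using real_point_in_New by fastforce
    have 0: "(0, 0) \<in> New L"
      using real_point_in_New[OF lattice_sets_quadrant[OF L, of 0 0]] by simp
    have "(1 - t / real c) *\<^sub>R (0, 0) + (t / real c) *\<^sub>R (real S * real c, - real c) \<in> New L"
      using lt t(1) by (intro convexD[OF convex_New 0 1]) auto
    then show False using lt t by (simp add: mult.commute)
  qed
  moreover have "c \<le> nat \<lceil>t\<rceil>" if "real c \<le> t" for c using that by linarith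
  ultimately have "{c::nat. \<exists>x \<le> int (S * c). (x, - int c) \<in> L} \<subseteq> {..nat \<lceil>t\<rceil>}" by blast
  then show ?thesis using finite_subset by blast
qed

lemma finite_minimizer:
  fixes f :: "'a \<Rightarrow> 'b::linorder"
  assumes "finite A" "A \<noteq> {}"
  obtains m where "m \<in> A" "\<And>x. x \<in> A \<Longrightarrow> f m \<le> f x"
proof -
  have "Min (f ` A) \<in> f ` A" using assms by simp
  then obtain m where "m \<in> A" "f m = Min (f ` A)" by auto
  then show thesis using that assms by (metis Min_le finite_imageI imageI)
qed

text \<open>Let \<open>g c\<close> be the least abscissa at height \<open>-c\<close>. Among all pairs of boundary points, one above
height \<open>-h\<close> and one at or below it, a pair is chosen whose chord has minimal abscissa at height
\<open>-(h - 1/2)\<close>. The minimum exists because \<open>g\<close> is superlinear, which leaves finitely many candidates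
for the lower point. By minimality no point of \<open>L\<close> is to the left of the line through the pair, so
that line cuts out a facet. It is bounded, because it contains points of different heights, one of them
negative, unlike the unbounded facets; hence the slope is an integer. Its lattice points at the heights \<open>-h\<close> and
\<open>-(h - 1)\<close> belong to \<open>L\<close> by integral closure.\<close>

lemma supporting_integer_line:
  assumes L: "L \<in> lattice_sets" and x1: "(x1, - int h) \<in> L" and h: "0 < h"
  obtains k :: nat and x0 where "0 < k" "(x0, - int h) \<in> L" "(x0 - int k, - int (h - 1)) \<in> L"
    "\<And>x y. (x, y) \<in> L \<Longrightarrow> x0 - int k * int h \<le> x + int k * y"
proof -
  define D where "D = {c::nat. \<exists>x. (x, - int c) \<in> L}"
  define g where "g c = (LEAST n. (int n, - int c) \<in> L)" for c
  have g_mem: "(int (g c), - int c) \<in> L" if "c \<in> D" for c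
  proof -
    obtain x where x: "(x, - int c) \<in> L" using \<open>c \<in> D\<close> by (auto simp: D_def)
    then have "(int (nat x), - int c) \<in> L" using lattice_sets_nonneg[OF L x] by simp
    then show ?thesis unfolding g_def by (rule LeastI)
  qed
  have g_le: "int (g c) \<le> x" if "(x, - int c) \<in> L" for x c
  proof -
    have "0 \<le> x" using lattice_sets_nonneg[OF L that] .
    then have "g c \<le> nat x" unfolding g_def using that by (intro Least_le) simp
    then show ?thesis using \<open>0 \<le> x\<close> by simp
  qed
  have down: "c' \<in> D \<and> g c' \<le> g c" if "c \<in> D" "c' \<le> c" for c c'
  proof -
    have "(int (g c), - int c') \<in> L" using lattice_sets_upward[OF L g_mem[OF that(1)]] that by simp
    then show ?thesis using g_le[of "int (g c)" c'] by (auto simp: D_def)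
  qed
  have hD: "h \<in> D" using x1 by (auto simp: D_def)
  have g0: "g 0 = 0" using g_le[of 0 0] lattice_sets_quadrant[OF L, of 0 0] by simp
  have gh: "0 < g h"
    using lattice_sets_axis[OF L, of "- int h"] g_mem[OF hD] h by (cases "g h = 0") auto
  \<comment> \<open>a chord with lower end at height \<open>-q\<close> and \<open>g q > S q\<close> has abscissa larger than
  \<open>S / 2 = g h\<close> at height \<open>-(h - 1/2)\<close>, which the chord from \<open>(0, 0)\<close> to \<open>(g h, -h)\<close> beats\<close>
  define S where "S = 2 * g h"
  define Q where "Q = {q \<in> D. h \<le> q \<and> g q \<le> S * q}"
  define val where "val = (\<lambda>(p, q). real (g p)
    + (real (g q) - real (g p)) * ((real h - 1/2 - real p) / (real q - real p)))"
  have "Q \<subseteq> {c. \<exists>x \<le> int (S * c). (x, - int c) \<in> L}"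
  proof
    fix q assume "q \<in> Q"
    then have "int (g q) \<le> int (S * q)" "(int (g q), - int q) \<in> L"
      using g_mem by (simp_all only: Q_def mem_Collect_eq of_nat_le_iff)
    then show "q \<in> {c. \<exists>x \<le> int (S * c). (x, - int c) \<in> L}" by blast
  qed
  then have "finite Q" using finite_heights_above_line[OF L, of S] gh finite_subset
    unfolding S_def by fastforce
  moreover have hQ: "h \<in> Q" using hD h by (auto simp: Q_def S_def)
  ultimately obtain m where m: "m \<in> {..<h} \<times> Q" "\<And>z. z \<in> {..<h} \<times> Q \<Longrightarrow> val m \<le> val z"
    using finite_minimizer[of "{..<h} \<times> Q" val] h by (metis empty_iff finite_SigmaI finite_lessThan
      lessThan_iff mem_Sigma_iff)
  obtain p q where pq: "m = (p, q)" by fastforce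
  have p: "p < h" and q: "q \<in> D" "h \<le> q" "p < q" using m(1) pq by (auto simp: Q_def)
  then have pD: "p \<in> D" using down by auto
  have minimal: "val (p, q) \<le> val (p', q')" if p': "p' < h" and q': "q' \<in> D" "h \<le> q'" for p' q'
  proof (cases "q' \<in> Q")
    case True
    then show ?thesis using m(2)[of "(p', q')"] p' pq by simp
  next
    case False
    then have big: "S * q' < g q'" using q' by (simp add: Q_def)
    define t where "t = (real h - 1/2 - real p') / (real q' - real p')"
    have den: "0 < real q' - real p'" using p' q' by simp
    have ph: "real p' + 1 \<le> real h" using p' by linarith
    have t1: "t \<le> 1" using den q' by (simp add: t_def)
    have "(1/2) / real q' \<le> t"
      unfolding t_def using den ph q' by (intro frac_le) auto
    then have "real (g q') * ((1/2) / real q') \<le> real (g q') * t" by (rule mult_left_mono) simp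
    moreover have "real (g h) < real (g q') * ((1/2) / real q')"
    proof -
      have "real (S * q') < real (g q')" using big by (simp only: of_nat_less_iff)
      then show ?thesis using h q' by (simp add: S_def field_simps)
    qed
    moreover have "val (p', q') = real (g p') * (1 - t) + real (g q') * t"
    proof -
      have "val (p', q') = real (g p') + (real (g q') - real (g p')) * t"
        by (simp only: val_def t_def prod.case)
      then show ?thesis by (simp add: algebra_simps)
    qed
    moreover have "0 \<le> real (g p') * (1 - t)" using t1 by simp
    moreover have "val (0, h) \<le> real (g h)"
    proof -
      have "(real h - 1/2) / real h \<le> 1" using h by simp
      then have "real (g h) * ((real h - 1/2) / real h) \<le> real (g h) * 1"
        by (intro mult_left_mono) auto
      then show ?thesis by (simp add: val_def g0)
    qed
    moreover have "val (p, q) \<le> val (0, h)" using m(2)[of "(0, h)"] pq hQ h by simp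
    ultimately show ?thesis by linarith
  qed
  define s where "s = (real (g q) - real (g p)) / (real q - real p)"
  have s: "real (g q) - real (g p) = s * (real q - real p)" using q by (simp add: s_def)
  have val_pq: "val (p, q) = real (g p) + s * (real h - 1/2 - real p)"
    by (simp add: val_def s_def)
  have below: "real (g p) + s * (real c - real p) \<le> real (g c)" if c: "c \<in> D" for c
  proof (cases "h \<le> c")
    case True
    define e where "e = (real (g c) - real (g p)) / (real c - real p)"
    have e: "real (g c) - real (g p) = e * (real c - real p)" using p True by (simp add: e_def)
    have "val (p, c) = real (g p) + e * (real h - 1/2 - real p)" by (simp add: val_def e_def)
    then have "s * (real h - 1/2 - real p) \<le> e * (real h - 1/2 - real p)"
      using minimal[OF p c True] val_pq by simp
    moreover have "real p + 1 \<le> real h" using p by linarith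
    ultimately have "s \<le> e" by (simp add: mult_le_cancel_right)
    then have "s * (real c - real p) \<le> e * (real c - real p)" using p True by (intro mult_right_mono) auto
    then show ?thesis using e by simp
  next
    case False
    define e where "e = (real (g q) - real (g c)) / (real q - real c)"
    have e: "real (g q) - real (g c) = e * (real q - real c)" using q False by (simp add: e_def)
    have "val (c, q) = real (g c) + e * (real h - 1/2 - real c)" by (simp add: val_def e_def)
    then have "val (c, q) = real (g q) - e * (real q - real h + 1/2)" using e by (simp add: algebra_simps)
    moreover have "val (p, q) = real (g q) - s * (real q - real h + 1/2)"
      using val_pq s by (simp add: algebra_simps)
    ultimately have "e * (real q - real h + 1/2) \<le> s * (real q - real h + 1/2)"
      using minimal[of c q] False q by simp
    then have "e \<le> s" using q by (simp add: mult_le_cancel_right)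
    then have "e * (real q - real c) \<le> s * (real q - real c)" using False q by (intro mult_right_mono) auto
    then show ?thesis using e s by (simp add: algebra_simps)
  qed
  define r where "r = real (g p) - s * real p"
  have s0: "0 \<le> s" using down[OF q(1), of p] q by (simp add: s_def)
  have r0: "r \<le> 0" using below[of 0] down[OF hD, of 0] g0 by (simp add: r_def algebra_simps)
  have supp: "r \<le> real_of_int x + s * real_of_int y" if xy: "(x, y) \<in> L" for x y
  proof (cases "0 \<le> y")
    case True
    then have "0 \<le> s * real_of_int y" using s0 by simp
    moreover have "0 \<le> real_of_int x" using lattice_sets_nonneg[OF L xy] by simp
    ultimately show ?thesis using r0 by linarith
  next
    case False
    define c where "c = nat (- y)"
    have c: "y = - int c" using False by (simp add: c_def)
    then have "c \<in> D" "int (g c) \<le> x" using xy g_le by (auto simp: D_def)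
    then have "real (g c) \<le> real_of_int x" by (metis of_int_le_iff of_int_of_nat_eq)
    then show ?thesis using below[OF \<open>c \<in> D\<close>] c by (simp add: r_def algebra_simps)
  qed
  define F where "F = New L \<inter> {z. (1, s) \<bullet> z = r}"
  have face: "F face_of New L"
    unfolding F_def
  proof (rule face_of_Int_supporting_hyperplane_ge[OF convex_New], rule New_halfspace)
    fix u assume "u \<in> L"
    then show "r \<le> (1, s) \<bullet> real_point u" using supp by (cases u) simp
  qed
  have Pp: "(real (g p), - real p) \<in> New L" and Pq: "(real (g q), - real q) \<in> New L"
    using real_point_in_New[OF g_mem[OF pD]] real_point_in_New[OF g_mem[OF q(1)]] by simp_all
  have Fp: "(real (g p), - real p) \<in> F" and Fq: "(real (g q), - real q) \<in> F"
    using Pp Pq s by (auto simp: F_def r_def algebra_simps)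
  have facet: "F facet_of New L"
  proof (rule planar_face_is_facet(1)[OF convex_New face _ Fp Fq])
    have "(1, 0) \<in> New L" using real_point_in_New[OF lattice_sets_quadrant[OF L, of 1 0]] by simp
    moreover have "(1, 0) \<notin> F" using r0 by (simp add: F_def)
    ultimately show "F \<noteq> New L" by blast
    show "(real (g p), - real p) \<noteq> (real (g q), - real q)" using q by simp
  qed
  have "bounded F"
  proof (rule ccontr)
    assume "\<not> bounded F"
    then have "F = {(0, y) | y. 0 \<le> y} \<or> (\<exists>c d. F = {(x, d) | x. c \<le> x})"
      using L facet unfolding lattice_sets_def by blast
    then show False
    proof (elim disjE exE)
      assume "F = {(0, y) | y. 0 \<le> y}"
      then show False using Fq q h by simp
    next
      fix c d assume "F = {(x, d) | x. c \<le> x}"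
      then show False using Fp Fq q by auto
    qed
  qed
  then obtain c d k m where km: "0 < k" "0 < m"
      "F = closed_segment (real_point (c, d)) (real_point (c + m * k, d - m))"
    using L facet unfolding lattice_sets_def by blast
  have sk: "s = real_of_int k"
  proof -
    have "real_point (c, d) \<in> F" "real_point (c + m * k, d - m) \<in> F" using km(3) by auto
    then have "real_of_int c + s * real_of_int d = r"
        "real_of_int c + real_of_int m * real_of_int k + s * (real_of_int d - real_of_int m) = r"
      by (simp_all add: F_def)
    then have "real_of_int m * s = real_of_int m * real_of_int k"
      by (simp only: right_diff_distrib mult.commute[of s "real_of_int m"])
    then show ?thesis using km(2) by simp
  qed
  have on_line: "(int (g p) + k * (int c - int p), - int c) \<in> L" if "p \<le> c" "c \<le> q" for c
  proof (rule lattice_sets_closed[OF L])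
    define t where "t = (real c - real p) / (real q - real p)"
    have t: "0 \<le> t" "t \<le> 1" "t * (real q - real p) = real c - real p"
      using that q by (auto simp: t_def)
    have "(1 - t) *\<^sub>R (real (g p), - real p) + t *\<^sub>R (real (g q), - real q) \<in> New L"
      using t by (intro convexD[OF convex_New Pp Pq]) auto
    moreover have "(1 - t) * real (g p) + t * real (g q) = real (g p) + real_of_int k * (real c - real p)"
    proof -
      have "(1 - t) * real (g p) + t * real (g q) = real (g p) + t * (real (g q) - real (g p))"
        by (simp add: algebra_simps)
      also have "\<dots> = real (g p) + real_of_int k * (t * (real q - real p))"
        using s sk by simp
      finally show ?thesis using t(3) by simp
    qed
    moreover have "(1 - t) * - real p + t * - real q = - real c" using t(3) by (simp add: algebra_simps)
    ultimately show "real_point (int (g p) + k * (int c - int p), - int c) \<in> New L" by simp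
  qed
  define x0 where "x0 = int (g p) + k * (int h - int p)"
  show thesis
  proof (rule that[of "nat k" x0])
    show "0 < nat k" using km by simp
    show "(x0, - int h) \<in> L" using on_line[of h] p q by (simp add: x0_def)
    show "(x0 - int (nat k), - int (h - 1)) \<in> L"
      using on_line[of "h - 1"] p q km h by (simp add: x0_def of_nat_diff algebra_simps)
    fix x y assume "(x, y) \<in> L"
    then have "real_of_int (int (g p) - k * int p) \<le> real_of_int (x + k * y)"
      using supp[of x y] by (simp add: r_def sk)
    then show "x0 - int (nat k) * int h \<le> x + int (nat k) * y"
      using km by (simp only: of_int_le_iff) (simp add: x0_def algebra_simps)
  qed
qed

text \<open>With \<open>\<phi> k\<close> the maximum of \<open>- (x + k y)\<close> over \<open>L\<close>, the entries of the sequence are the second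
differences of \<open>\<phi>\<close>. The values \<open>\<phi> 0 = \<phi> 1 = 0\<close> needed to recover \<open>\<phi>\<close> from them express that
\<open>L\<close> is in the right half-plane and that the first edge has slope at least one.\<close>

lemma ex_slope_set_of_lattice_set:
  assumes L: "L \<in> lattice_sets"
  obtains a where "a \<in> (\<Pi>\<^sub>E j\<in>{1..}. UNIV)" "L = slope_set a"
proof -
  define bound where "bound k n \<longleftrightarrow> (\<forall>x y. (x, y) \<in> L \<longrightarrow> - int n \<le> x + int k * y)" for k n :: nat
  define \<phi> where "\<phi> k = (LEAST n. bound k n)" for k
  have ex_bound: "\<exists>n. bound k n" for k
  proof (cases "k = 0")
    case True
    then show ?thesis using lattice_sets_nonneg[OF L] by (auto simp: bound_def intro!: exI[of _ 0])
  next
    case False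
    define C where "C = {c::nat. \<exists>x \<le> int (k * c). (x, - int c) \<in> L}"
    have "finite C" unfolding C_def using finite_heights_above_line[OF L] False by simp
    have "- int (k * Max (insert 0 C)) \<le> x + int k * y" if xy: "(x, y) \<in> L" for x y
    proof (cases "0 \<le> x + int k * y")
      case False
      have x: "0 \<le> x" using lattice_sets_nonneg[OF L xy] .
      have "y < 0" using False x by (smt (verit) mult_nonneg_nonneg of_nat_0_le_iff)
      then have y: "y = - int (nat (- y))" by simp
      then have "x < int k * int (nat (- y))" using False by (metis minus_mult_right not_le add.commute
          ab_group_add_class.ab_diff_conv_add_uminus diff_less_0_iff_less)
      then have "x \<le> int (k * nat (- y))" by simp
      then have "nat (- y) \<in> C" unfolding C_def using xy y by auto
      then have "nat (- y) \<le> Max (insert 0 C)" using \<open>finite C\<close> by simp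
      then have "int (k * nat (- y)) \<le> int (k * Max (insert 0 C))" by (simp only: of_nat_le_iff mult_le_mono2)
      then show ?thesis using x y by (simp add: algebra_simps)
    qed (auto intro: order_trans[of _ 0])
    then show ?thesis unfolding bound_def by blast
  qed
  have \<phi>_bound: "- int (\<phi> k) \<le> x + int k * y" if "(x, y) \<in> L" for x y k
    using LeastI_ex[OF ex_bound[of k]] that by (simp add: \<phi>_def bound_def)
  have \<phi>_le: "int (\<phi> k) \<le> n" if "\<And>x y. (x, y) \<in> L \<Longrightarrow> - n \<le> x + int k * y" for k n
  proof -
    have "0 \<le> n" using that[of 0 0] lattice_sets_quadrant[OF L, of 0 0] by simp
    then have "\<phi> k \<le> nat n" unfolding \<phi>_def by (intro Least_le) (simp add: bound_def that)
    then show ?thesis using \<open>0 \<le> n\<close> by simp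
  qed
  have \<phi>0: "\<phi> 0 = 0" using \<phi>_le[where k = 0 and n = 0] lattice_sets_nonneg[OF L] by simp
  have \<phi>1: "\<phi> 1 = 0"
  proof -
    have "0 \<le> x + y" if xy: "(x, y) \<in> L" for x y
    proof (cases "0 \<le> y")
      case False
      then have "(x, - int 1) \<in> L" using lattice_sets_upward[OF L xy, of x "-1"] by simp
      then obtain k x0 where k: "0 < k" "(x0 - int k, - int (1 - 1)) \<in> L"
          "x0 - int k * int 1 \<le> x + int k * y"
        using supporting_integer_line[OF L, of x 1] xy by (metis zero_less_one)
      have "0 \<le> x + int k * y" using k lattice_sets_nonneg[OF L k(2)] by simp
      moreover have "int k * y \<le> 1 * y" using k(1) False by (intro mult_right_mono_neg) auto
      ultimately show ?thesis by simp
    qed (use lattice_sets_nonneg[OF L xy] in simp)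
    then show ?thesis using \<phi>_le[of 0 1] by simp
  qed
  have convex: "2 * int (\<phi> (Suc k)) \<le> int (\<phi> k) + int (\<phi> (Suc (Suc k)))" for k
  proof -
    have "\<exists>x y. (x, y) \<in> L \<and> x + int (Suc k) * y \<le> - int (\<phi> (Suc k))"
    proof (rule ccontr)
      assume "\<not> ?thesis"
      then have "int (\<phi> (Suc k)) \<le> int (\<phi> (Suc k)) - 1" by (intro \<phi>_le) fastforce
      then show False by simp
    qed
    then obtain x y where xy: "(x, y) \<in> L" "x + int (Suc k) * y \<le> - int (\<phi> (Suc k))" by blast
    show ?thesis
      using \<phi>_bound[OF xy(1), of k] \<phi>_bound[OF xy(1), of "Suc (Suc k)"] xy(2)
      by (simp add: algebra_simps)
  qed
  define d where "d k = int (\<phi> (Suc k)) - int (\<phi> k)" for k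
  define a where "a = (\<lambda>j\<in>{1..}. nat (d j - d (j - 1)))"
  have desc: "int (descent a k) = d k" for k
  proof (induction k)
    case 0
    then show ?case using \<phi>0 \<phi>1 by (simp add: d_def)
  next
    case (Suc k)
    have "d k \<le> d (Suc k)" using convex[of k] by (simp add: d_def)
    then show ?case using Suc by (simp add: a_def)
  qed
  have supp: "support a k = \<phi> k" for k
  proof (induction k)
    case (Suc k)
    then have "int (support a (Suc k)) = int (\<phi> (Suc k))" using desc[of k] by (simp add: d_def)
    then show ?case by simp
  qed (simp add: \<phi>0)
  have "L = slope_set a"
  proof (intro equalityI subsetI)
    fix u assume "u \<in> L"
    moreover obtain x y where xy: "u = (x, y)" by fastforce
    ultimately have "- int (\<phi> k) \<le> x + int k * y" for k using \<phi>_bound by blast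
    then show "u \<in> slope_set a" by (simp add: xy slope_set_def supp) (smt (verit))
  next
    fix u assume u: "u \<in> slope_set a"
    obtain x y where xy: "u = (x, y)" by fastforce
    have ge: "- (x + int k * y) \<le> int (\<phi> k)" for k
      using slope_set_memD[of x y a k] u xy supp by simp
    have x: "0 \<le> x" using ge[of 0] \<phi>0 by simp
    show "u \<in> L"
    proof (cases "0 \<le> y")
      case True
      then show ?thesis using lattice_sets_quadrant[OF L x] xy by simp
    next
      case False
      define h where "h = nat (- y)"
      have h: "0 < h" "y = - int h" using False by (auto simp: h_def)
      show ?thesis
      proof (cases "\<exists>x1. (x1, - int h) \<in> L")
        case True
        then obtain x1 where "(x1, - int h) \<in> L" by blast
        then obtain k x0 where k: "(x0, - int h) \<in> L"
            "\<And>x y. (x, y) \<in> L \<Longrightarrow> x0 - int k * int h \<le> x + int k * y"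
          using supporting_integer_line[OF L _ h(1)] by metis
        have "int (\<phi> k) \<le> int k * int h - x0" using k(2) by (intro \<phi>_le) simp
        then have "x0 \<le> x" using ge[of k] h by simp
        then show ?thesis using lattice_sets_upward[OF L k(1)] h xy by simp
      next
        case False
        have "int (\<phi> k) \<le> int k * (int h - 1)" for k
        proof (rule \<phi>_le)
          fix x' y' assume xy': "(x', y') \<in> L"
          have "- int h < y'"
          proof (rule ccontr)
            assume "\<not> - int h < y'"
            then show False using lattice_sets_upward[OF L xy', of x' "- int h"] False by auto
          qed
          then have "int k * (- (int h - 1)) \<le> int k * y'" by (intro mult_left_mono) auto
          then show "- (int k * (int h - 1)) \<le> x' + int k * y'"
            using lattice_sets_nonneg[OF L xy'] by (simp only: mult_minus_right)
        qed
        from this[of "Suc (nat x)"] ge[of "Suc (nat x)"] have False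
          using h x by (simp add: algebra_simps)
        then show ?thesis ..
      qed
    qed
  qed
  moreover have "a \<in> (\<Pi>\<^sub>E j\<in>{1..}. UNIV)" by (simp add: a_def)
  ultimately show thesis using that by blast
qed

section \<open>Transport of topological monoid structure\<close>

lemma top_homD:
  assumes "f \<in> top_hom G H"
  shows "\<And>x. x \<in> carrier G \<Longrightarrow> f x \<in> carrier H"
    and "\<And>x y. x \<in> carrier G \<Longrightarrow> y \<in> carrier G \<Longrightarrow> f (x \<otimes>\<^bsub>G\<^esub> y) = f x \<otimes>\<^bsub>H\<^esub> f y"
    and "f \<one>\<^bsub>G\<^esub> = \<one>\<^bsub>H\<^esub>" and "continuous_map (topo G) (topo H) f"
  using assms by (auto simp: top_hom_def hom_def)

lemma top_homI:
  assumes "\<And>x. x \<in> carrier G \<Longrightarrow> f x \<in> carrier H"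
    and "\<And>x y. x \<in> carrier G \<Longrightarrow> y \<in> carrier G \<Longrightarrow> f (x \<otimes>\<^bsub>G\<^esub> y) = f x \<otimes>\<^bsub>H\<^esub> f y"
    and "f \<one>\<^bsub>G\<^esub> = \<one>\<^bsub>H\<^esub>" and "continuous_map (topo G) (topo H) f"
  shows "f \<in> top_hom G H"
  using assms by (auto simp: top_hom_def hom_def)

lemma top_isoD:
  assumes "f \<in> top_iso G H"
  shows "f \<in> top_hom G H" "bij_betw f (carrier G) (carrier H)"
    "homeomorphic_map (topo G) (topo H) f"
  using assms by (auto simp: top_iso_def)

lemma top_isoI:
  assumes "f \<in> top_hom G H" "homeomorphic_map (topo G) (topo H) f"
    and "topspace (topo G) = carrier G" "topspace (topo H) = carrier H"
  shows "f \<in> top_iso G H"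
  using assms homeomorphic_imp_injective_map[OF assms(2)] homeomorphic_imp_surjective_map[OF assms(2)]
  by (simp add: top_iso_def bij_betw_def)

lemma top_comm_monoidD:
  assumes "top_comm_monoid G"
  shows "topspace (topo G) = carrier G" "\<one>\<^bsub>G\<^esub> \<in> carrier G"
    "\<And>x y. x \<in> carrier G \<Longrightarrow> y \<in> carrier G \<Longrightarrow> x \<otimes>\<^bsub>G\<^esub> y \<in> carrier G"
proof -
  interpret top_comm_monoid G by fact
  show "topspace (topo G) = carrier G" "\<one>\<^bsub>G\<^esub> \<in> carrier G"
    "\<And>x y. x \<in> carrier G \<Longrightarrow> y \<in> carrier G \<Longrightarrow> x \<otimes>\<^bsub>G\<^esub> y \<in> carrier G"
    by (simp_all add: topspace_topo)
qed

lemma top_iso_cong: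
  assumes "f \<in> top_iso G H" "top_comm_monoid G" "\<And>x. x \<in> carrier G \<Longrightarrow> f x = g x"
  shows "g \<in> top_iso G H"
proof -
  note G = top_comm_monoidD[OF assms(2)] and f = top_isoD[OF assms(1)]
  have "g \<in> top_hom G H"
    using top_homD[OF f(1)] G assms(3) by (intro top_homI) (auto intro: continuous_map_eq)
  moreover have "bij_betw g (carrier G) (carrier H)"
    using f(2) assms(3) by (simp cong: bij_betw_cong)
  moreover have "homeomorphic_map (topo G) (topo H) g"
    using homeomorphic_map_eq[OF f(3)] assms(3) G(1) by simp
  ultimately show ?thesis by (simp add: top_iso_def)
qed

text \<open>This spares a direct proof that addition of lattice sets is continuous.\<close>

lemma top_comm_monoid_transport:
  fixes G :: "'a top_monoid" and H :: "'b top_monoid"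
  assumes G: "top_comm_monoid G" and f: "f \<in> top_iso G H"
  shows "top_comm_monoid H"
proof -
  interpret G: top_comm_monoid G by (rule G)
  note hom = top_homD[OF top_isoD(1)[OF f]]
  have surj: "\<exists>x\<in>carrier G. y = f x" if "y \<in> carrier H" for y
    using that bij_betw_imp_surj_on[OF top_isoD(2)[OF f]] by blast
  obtain g where "homeomorphic_maps (topo G) (topo H) f g"
    using top_isoD(3)[OF f] homeomorphic_map_maps by blast
  then have g: "continuous_map (topo H) (topo G) g" "\<And>y. y \<in> topspace (topo H) \<Longrightarrow> f (g y) = y"
    by (auto simp: homeomorphic_maps_def)
  have topH: "topspace (topo H) = carrier H"
    using homeomorphic_imp_surjective_map[OF top_isoD(3)[OF f]] bij_betw_imp_surj_on[OF top_isoD(2)[OF f]]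
      G.topspace_topo by simp
  have g_mem: "g y \<in> carrier G" if "y \<in> carrier H" for y
    using g(1) that topH G.topspace_topo by (auto simp: continuous_map_def)
  have "comm_monoid H"
  proof (rule comm_monoidI)
    fix x y assume x: "x \<in> carrier H" and y: "y \<in> carrier H"
    obtain a b where ab: "a \<in> carrier G" "b \<in> carrier G" "x = f a" "y = f b"
      using surj[OF x] surj[OF y] by auto
    show "x \<otimes>\<^bsub>H\<^esub> y \<in> carrier H" using ab hom(1) by (simp add: hom(2)[symmetric])
    show "x \<otimes>\<^bsub>H\<^esub> y = y \<otimes>\<^bsub>H\<^esub> x" using ab by (simp add: hom(2)[symmetric] G.m_comm)
    show "\<one>\<^bsub>H\<^esub> \<otimes>\<^bsub>H\<^esub> x = x" using ab by (simp add: hom(2,3)[symmetric])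
    fix z assume "z \<in> carrier H"
    then obtain c where c: "c \<in> carrier G" "z = f c" using surj by blast
    show "x \<otimes>\<^bsub>H\<^esub> y \<otimes>\<^bsub>H\<^esub> z = x \<otimes>\<^bsub>H\<^esub> (y \<otimes>\<^bsub>H\<^esub> z)"
      using ab c by (simp add: hom(2)[symmetric] G.m_assoc)
  next
    show "\<one>\<^bsub>H\<^esub> \<in> carrier H" using hom(1,3) by (metis G.one_closed)
  qed
  moreover have "continuous_map (prod_topology (topo H) (topo H)) (topo H) (\<lambda>(x, y). x \<otimes>\<^bsub>H\<^esub> y)"
  proof (rule continuous_map_eq)
    have "continuous_map (prod_topology (topo H) (topo H)) (prod_topology (topo G) (topo G))
        (\<lambda>(x, y). (g x, g y))"
      using g(1) by (simp add: continuous_map_prod_top)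
    then show "continuous_map (prod_topology (topo H) (topo H)) (topo H)
        (f \<circ> ((\<lambda>(x, y). x \<otimes>\<^bsub>G\<^esub> y) \<circ> (\<lambda>(x, y). (g x, g y))))"
      by (intro continuous_map_compose[OF _ hom(4)] continuous_map_compose[OF _ G.continuous_mult])
    fix z assume "z \<in> topspace (prod_topology (topo H) (topo H))"
    then show "(f \<circ> ((\<lambda>(x, y). x \<otimes>\<^bsub>G\<^esub> y) \<circ> (\<lambda>(x, y). (g x, g y)))) z = (\<lambda>(x, y). x \<otimes>\<^bsub>H\<^esub> y) z"
      using g(2) g_mem hom(2) topH by auto
  qed
  ultimately show ?thesis
    unfolding top_comm_monoid_def top_comm_monoid_axioms_def using topH by blast
qed

text \<open>In this and the next two lemmas, \<open>r\<close> is the map \<open>e' \<circ> f \<circ> e\<^sup>-\<^sup>1\<close>, expressed without naming an inverse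
of \<open>e\<close>.\<close>

lemma top_hom_conjugate:
  fixes G :: "'a top_monoid" and H :: "'b top_monoid"
    and G' :: "'c top_monoid" and H' :: "'d top_monoid"
  assumes G: "top_comm_monoid G" and e: "e \<in> top_iso G H" and e': "e' \<in> top_hom G' H'"
    and f: "f \<in> top_hom G G'" and r: "\<And>x. x \<in> carrier G \<Longrightarrow> r (e x) = e' (f x)"
  shows "r \<in> top_hom H H'"
proof -
  note he = top_homD[OF top_isoD(1)[OF e]] and he' = top_homD[OF e'] and hf = top_homD[OF f]
  note G_closed = top_comm_monoidD[OF G]
  have surj: "\<exists>x\<in>carrier G. y = e x" if "y \<in> carrier H" for y
    using that bij_betw_imp_surj_on[OF top_isoD(2)[OF e]] by blast
  obtain g where "homeomorphic_maps (topo G) (topo H) e g"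
    using top_isoD(3)[OF e] homeomorphic_map_maps by blast
  then have g: "continuous_map (topo H) (topo G) g" "\<And>y. y \<in> topspace (topo H) \<Longrightarrow> e (g y) = y"
    by (auto simp: homeomorphic_maps_def)
  have g_mem: "g y \<in> carrier G" if "y \<in> topspace (topo H)" for y
    using g(1) that G_closed(1) by (auto simp: continuous_map_def)
  show ?thesis
  proof (rule top_homI)
    fix y assume "y \<in> carrier H"
    then obtain x where x: "x \<in> carrier G" "y = e x" using surj by blast
    show "r y \<in> carrier H'" using x r hf(1) he'(1) by simp
    fix y' assume "y' \<in> carrier H"
    then obtain x' where x': "x' \<in> carrier G" "y' = e x'" using surj by blast
    have "r (y \<otimes>\<^bsub>H\<^esub> y') = r (e (x \<otimes>\<^bsub>G\<^esub> x'))" using x x' he(2) by simp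
    also have "\<dots> = e' (f x \<otimes>\<^bsub>G'\<^esub> f x')" using x x' r G_closed hf(2) by simp
    also have "\<dots> = r y \<otimes>\<^bsub>H'\<^esub> r y'" using x x' r hf(1) he'(2) by simp
    finally show "r (y \<otimes>\<^bsub>H\<^esub> y') = r y \<otimes>\<^bsub>H'\<^esub> r y'" .
  next
    show "r \<one>\<^bsub>H\<^esub> = \<one>\<^bsub>H'\<^esub>" using r[OF G_closed(2)] he(3) hf(3) he'(3) by simp
    show "continuous_map (topo H) (topo H') r"
    proof (rule continuous_map_eq)
      show "continuous_map (topo H) (topo H') (e' \<circ> (f \<circ> g))"
        by (intro continuous_map_compose[OF _ he'(4)] continuous_map_compose[OF g(1) hf(4)])
      fix y assume "y \<in> topspace (topo H)"
      then show "(e' \<circ> (f \<circ> g)) y = r y" using g(2) g_mem r by (metis comp_apply)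
    qed
  qed
qed

lemma top_epi_conjugate:
  fixes G :: "'a top_monoid" and H :: "'b top_monoid"
    and G' :: "'c top_monoid" and H' :: "'d top_monoid"
  assumes G: "top_comm_monoid G" and e: "e \<in> top_iso G H" and e': "e' \<in> top_iso G' H'"
    and f: "f \<in> top_epi G G'" and r: "\<And>x. x \<in> carrier G \<Longrightarrow> r (e x) = e' (f x)"
  shows "r \<in> top_epi H H'"
proof -
  have f_hom: "f \<in> top_hom G G'" and f_surj: "f ` carrier G = carrier G'"
    using f by (auto simp: top_epi_def)
  have "r \<in> top_hom H H'"
    by (rule top_hom_conjugate[OF G e top_isoD(1)[OF e'] f_hom]) (fact r)
  moreover have "r ` carrier H = carrier H'"
  proof -
    have "r ` carrier H = r ` e ` carrier G"
      using bij_betw_imp_surj_on[OF top_isoD(2)[OF e]] by simp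
    also have "\<dots> = e' ` f ` carrier G" using r by (force simp: image_image)
    also have "\<dots> = carrier H'"
      using bij_betw_imp_surj_on[OF top_isoD(2)[OF e']] f_surj by simp
    finally show ?thesis .
  qed
  ultimately show ?thesis by (simp add: top_epi_def)
qed

lemma top_iso_conjugate:
  fixes G :: "'a top_monoid" and H :: "'b top_monoid"
    and G' :: "'c top_monoid" and H' :: "'d top_monoid"
  assumes G: "top_comm_monoid G" and e: "e \<in> top_iso G H" and e': "e' \<in> top_iso G' H'"
    and f: "f \<in> top_iso G G'" and r: "\<And>x. x \<in> carrier G \<Longrightarrow> r (e x) = e' (f x)"
  shows "r \<in> top_iso H H'"
proof -
  have hom: "r \<in> top_hom H H'"
    by (rule top_hom_conjugate[OF G e top_isoD(1)[OF e'] top_isoD(1)[OF f]]) (fact r)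
  have topG: "topspace (topo G) = carrier G" by (rule top_comm_monoidD(1)[OF G])
  obtain g where gm: "homeomorphic_maps (topo G) (topo H) e g"
    using top_isoD(3)[OF e] homeomorphic_map_maps by blast
  then have g: "homeomorphic_map (topo H) (topo G) g" "\<And>y. y \<in> topspace (topo H) \<Longrightarrow> e (g y) = y"
    by (auto simp: homeomorphic_maps_map)
  have "homeomorphic_map (topo H) (topo H') r"
  proof (rule homeomorphic_map_eq)
    show "homeomorphic_map (topo H) (topo H') (e' \<circ> (f \<circ> g))"
      using g(1) top_isoD(3)[OF f] top_isoD(3)[OF e'] by (intro homeomorphic_map_compose)
    fix y assume y: "y \<in> topspace (topo H)"
    then have "g y \<in> carrier G"
      using homeomorphic_imp_surjective_map[OF g(1)] topG by blast
    then show "(e' \<circ> (f \<circ> g)) y = r y" using g(2)[OF y] r by (metis comp_apply)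
  qed
  moreover have "bij_betw r (carrier H) (carrier H')"
  proof -
    have "bij_betw (e' \<circ> f) (carrier G) (carrier H')"
      using top_isoD(2)[OF f] top_isoD(2)[OF e'] by (rule bij_betw_trans)
    moreover have "(r \<circ> e) x = (e' \<circ> f) x" if "x \<in> carrier G" for x using r that by simp
    ultimately have "bij_betw (r \<circ> e) (carrier G) (carrier H')" by (simp cong: bij_betw_cong)
    then show ?thesis using bij_betw_comp_iff[OF top_isoD(2)[OF e]] by blast
  qed
  ultimately show ?thesis using hom by (simp add: top_iso_def)
qed

text \<open>The form in which both \<^const>\<open>seq_monoid_upto\<close> and \<^const>\<open>lattice_monoid_upto\<close> arise.\<close>

definition top_submonoid :: "'a top_monoid \<Rightarrow> 'a set \<Rightarrow> 'a top_monoid" where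
  "top_submonoid G S = G\<lparr>carrier := S, topo := subtopology (topo G) S\<rparr>"

lemma top_submonoid_simps [simp]:
  "carrier (top_submonoid G S) = S" "x \<otimes>\<^bsub>top_submonoid G S\<^esub> y = x \<otimes>\<^bsub>G\<^esub> y"
  "\<one>\<^bsub>top_submonoid G S\<^esub> = \<one>\<^bsub>G\<^esub>" "topo (top_submonoid G S) = subtopology (topo G) S"
  by (simp_all add: top_submonoid_def)

lemma top_comm_monoid_submonoid:
  fixes G :: "'a top_monoid"
  assumes G: "top_comm_monoid G" and S: "S \<subseteq> carrier G" "\<one>\<^bsub>G\<^esub> \<in> S"
    "\<And>x y. x \<in> S \<Longrightarrow> y \<in> S \<Longrightarrow> x \<otimes>\<^bsub>G\<^esub> y \<in> S"
  shows "top_comm_monoid (top_submonoid G S)"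
proof -
  interpret G: top_comm_monoid G by (rule G)
  have "comm_monoid (top_submonoid G S)"
  proof (rule comm_monoidI)
    fix x y z assume "x \<in> carrier (top_submonoid G S)" "y \<in> carrier (top_submonoid G S)"
      "z \<in> carrier (top_submonoid G S)"
    then have "x \<in> carrier G" "y \<in> carrier G" "z \<in> carrier G" using S(1) by auto
    then show "x \<otimes>\<^bsub>top_submonoid G S\<^esub> y \<otimes>\<^bsub>top_submonoid G S\<^esub> z
        = x \<otimes>\<^bsub>top_submonoid G S\<^esub> (y \<otimes>\<^bsub>top_submonoid G S\<^esub> z)"
      by (simp add: G.m_assoc)
  next
    fix x y assume "x \<in> carrier (top_submonoid G S)" "y \<in> carrier (top_submonoid G S)"
    then have "x \<in> carrier G" "y \<in> carrier G" using S(1) by auto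
    then show "x \<otimes>\<^bsub>top_submonoid G S\<^esub> y = y \<otimes>\<^bsub>top_submonoid G S\<^esub> x"
      by (simp add: G.m_comm)
  qed (use S in auto)
  moreover have "continuous_map (prod_topology (subtopology (topo G) S) (subtopology (topo G) S))
      (subtopology (topo G) S) (\<lambda>(x, y). x \<otimes>\<^bsub>G\<^esub> y)"
  proof (rule continuous_map_into_subtopology)
    show "continuous_map (prod_topology (subtopology (topo G) S) (subtopology (topo G) S)) (topo G)
        (\<lambda>(x, y). x \<otimes>\<^bsub>G\<^esub> y)"
      unfolding subtopology_Times[symmetric]
      by (rule continuous_map_from_subtopology) (rule G.continuous_mult)
  qed (use S(3) in auto)
  moreover have "topspace (subtopology (topo G) S) = S" using S(1) G.topspace_topo by auto
  ultimately show ?thesis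
    unfolding top_comm_monoid_def top_comm_monoid_axioms_def by simp
qed

lemma top_hom_submonoid:
  assumes "f \<in> top_hom G H" "S \<subseteq> carrier G" "\<And>x. x \<in> S \<Longrightarrow> f x \<in> T"
  shows "f \<in> top_hom (top_submonoid G S) (top_submonoid H T)"
proof (rule top_homI)
  have "continuous_map (subtopology (topo G) S) (topo H) f"
    using top_homD(4)[OF assms(1)] by (rule continuous_map_from_subtopology)
  then show "continuous_map (topo (top_submonoid G S)) (topo (top_submonoid H T)) f"
    using assms(3) by (auto intro: continuous_map_into_subtopology)
qed (use top_homD[OF assms(1)] assms(2,3) in auto)

lemma top_iso_submonoid:
  assumes G: "topspace (topo G) = carrier G" "topspace (topo H) = carrier H"
    and f: "f \<in> top_iso G H" and S: "S \<subseteq> carrier G" and T: "f ` S = T"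
  shows "f \<in> top_iso (top_submonoid G S) (top_submonoid H T)"
proof (rule top_isoI)
  have T': "T \<subseteq> carrier H" using S T top_homD(1)[OF top_isoD(1)[OF f]] by blast
  show "f \<in> top_hom (top_submonoid G S) (top_submonoid H T)"
    using top_hom_submonoid[OF top_isoD(1)[OF f] S] T by blast
  show "homeomorphic_map (topo (top_submonoid G S)) (topo (top_submonoid H T)) f"
    using homeomorphic_map_subtopologies[OF top_isoD(3)[OF f], of S T] G S T T'
    by (simp add: Int_absorb1)
  show "topspace (topo (top_submonoid G S)) = carrier (top_submonoid G S)"
    "topspace (topo (top_submonoid H T)) = carrier (top_submonoid H T)"
    using G S T' by auto
qed

lemma inverse_limit_simps [simp]:
  "carrier (inverse_limit G p) = inverse_limit_carrier G p"
  "x \<otimes>\<^bsub>inverse_limit G p\<^esub> y = (\<lambda>n\<in>{1..}. x n \<otimes>\<^bsub>G n\<^esub> y n)"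
  "\<one>\<^bsub>inverse_limit G p\<^esub> = (\<lambda>n\<in>{1..}. \<one>\<^bsub>G n\<^esub>)"
  "topo (inverse_limit G p)
    = subtopology (product_topology (\<lambda>n. topo (G n)) {1..}) (inverse_limit_carrier G p)"
  by (simp_all add: inverse_limit_def)

lemma topspace_inverse_limit:
  assumes "\<And>n. 1 \<le> n \<Longrightarrow> topspace (topo (G n)) = carrier (G n)"
  shows "topspace (topo (inverse_limit G p)) = inverse_limit_carrier G p"
proof -
  have "(\<Pi>\<^sub>E n\<in>{1..}. topspace (topo (G n))) = (\<Pi>\<^sub>E n\<in>{1..}. carrier (G n))"
    using assms by (intro PiE_cong) auto
  then show ?thesis by (auto simp: inverse_limit_carrier_def)
qed

lemma inverse_limit_component_continuous:
  "1 \<le> n \<Longrightarrow> continuous_map (topo (inverse_limit G p)) (topo (G n)) (\<lambda>x. x n)"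
  unfolding inverse_limit_simps
  by (rule continuous_map_from_subtopology, rule continuous_map_product_projection) simp

lemma continuous_map_into_inverse_limit:
  assumes "\<And>x. x \<in> topspace X \<Longrightarrow> f x \<in> inverse_limit_carrier G p"
    and "\<And>n. 1 \<le> n \<Longrightarrow> continuous_map X (topo (G n)) (\<lambda>x. f x n)"
  shows "continuous_map X (topo (inverse_limit G p)) f"
  using assms
  by (auto intro!: continuous_map_into_subtopology
      simp: continuous_map_componentwise inverse_limit_carrier_def PiE_iff)

text \<open>The inverses of the components commute with the transition maps as well, because \<open>e\<close> is injective on
each carrier; so they assemble to an inverse of the induced map.\<close>

lemma inverse_limit_top_iso:
  fixes G :: "nat \<Rightarrow> 'a top_monoid" and H :: "nat \<Rightarrow> 'b top_monoid"
  assumes e: "\<And>n. 1 \<le> n \<Longrightarrow> e \<in> top_iso (G n) (H n)"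
    and G: "\<And>n. 1 \<le> n \<Longrightarrow> topspace (topo (G n)) = carrier (G n)"
    and H: "\<And>n. 1 \<le> n \<Longrightarrow> topspace (topo (H n)) = carrier (H n)"
    and p: "\<And>n x. 1 \<le> n \<Longrightarrow> x \<in> carrier (G (Suc n)) \<Longrightarrow> p n x \<in> carrier (G n)"
    and pq: "\<And>n x. 1 \<le> n \<Longrightarrow> x \<in> carrier (G (Suc n)) \<Longrightarrow> q n (e x) = e (p n x)"
  shows "(\<lambda>x. \<lambda>n\<in>{1..}. e (x n)) \<in> top_iso (inverse_limit G p) (inverse_limit H q)"
proof -
  define E where "E = (\<lambda>x. \<lambda>n\<in>{1::nat..}. e (x n))"
  note hom = top_homD[OF top_isoD(1)[OF e]]
  have "\<exists>g. homeomorphic_maps (topo (G n)) (topo (H n)) e g" if "1 \<le> n" for n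
    using top_isoD(3)[OF e[OF that]] homeomorphic_map_maps by blast
  then obtain g where g: "\<And>n. 1 \<le> n \<Longrightarrow> homeomorphic_maps (topo (G n)) (topo (H n)) e (g n)"
    by metis
  have g_cont: "continuous_map (topo (H n)) (topo (G n)) (g n)" if "1 \<le> n" for n
    using g[OF that] by (simp add: homeomorphic_maps_def)
  have ge: "g n (e x) = x" if "1 \<le> n" "x \<in> carrier (G n)" for n x
    using g[OF that(1)] G that by (auto simp: homeomorphic_maps_def)
  have eg: "g n y \<in> carrier (G n)" "e (g n y) = y" if "1 \<le> n" "y \<in> carrier (H n)" for n y
    using g[OF that(1)] G H that by (auto simp: homeomorphic_maps_def continuous_map_def)
  have E: "E x \<in> inverse_limit_carrier H q" if x: "x \<in> inverse_limit_carrier G p" for x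
    using x hom(1) pq by (auto simp: E_def inverse_limit_carrier_def PiE_iff)
  define E' where "E' = (\<lambda>y. \<lambda>n\<in>{1::nat..}. g n (y n))"
  have E': "E' y \<in> inverse_limit_carrier G p" if y: "y \<in> inverse_limit_carrier H q" for y
  proof -
    have y: "y n \<in> carrier (H n)" "q n (y (Suc n)) = y n" if "1 \<le> n" for n
      using y that by (auto simp: inverse_limit_carrier_def PiE_iff)
    have "p n (g (Suc n) (y (Suc n))) = g n (y n)" if n: "1 \<le> n" for n
    proof -
      have z: "g (Suc n) (y (Suc n)) \<in> carrier (G (Suc n))" using eg(1) y(1) by simp
      have "e (p n (g (Suc n) (y (Suc n)))) = y n"
        using pq[OF n z] eg(2)[of "Suc n"] y n by simp
      then show ?thesis using ge[OF n p[OF n z]] by simp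
    qed
    then show ?thesis using eg(1) y(1) by (auto simp: E'_def inverse_limit_carrier_def PiE_iff)
  qed
  have topG: "topspace (topo (inverse_limit G p)) = inverse_limit_carrier G p"
    using G by (rule topspace_inverse_limit)
  have topH: "topspace (topo (inverse_limit H q)) = inverse_limit_carrier H q"
    using H by (rule topspace_inverse_limit)
  have E_cont: "continuous_map (topo (inverse_limit G p)) (topo (inverse_limit H q)) E"
  proof (rule continuous_map_into_inverse_limit)
    fix n :: nat assume n: "1 \<le> n"
    have "continuous_map (topo (inverse_limit G p)) (topo (H n)) (e \<circ> (\<lambda>x. x n))"
      using inverse_limit_component_continuous[OF n] hom(4)[OF n] by (rule continuous_map_compose)
    then show "continuous_map (topo (inverse_limit G p)) (topo (H n)) (\<lambda>x. E x n)"
      using n by (simp add: E_def o_def)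
  qed (use E topG in simp)
  have E'_cont: "continuous_map (topo (inverse_limit H q)) (topo (inverse_limit G p)) E'"
  proof (rule continuous_map_into_inverse_limit)
    fix n :: nat assume n: "1 \<le> n"
    have "continuous_map (topo (inverse_limit H q)) (topo (G n)) (g n \<circ> (\<lambda>x. x n))"
      using inverse_limit_component_continuous[OF n] g_cont[OF n] by (rule continuous_map_compose)
    then show "continuous_map (topo (inverse_limit H q)) (topo (G n)) (\<lambda>x. E' x n)"
      using n by (simp add: E'_def o_def)
  qed (use E' topH in simp)
  have "E' (E x) = x" if "x \<in> inverse_limit_carrier G p" for x
    using that ge by (fastforce simp: E_def E'_def inverse_limit_carrier_def PiE_iff extensional_def)
  moreover have "E (E' y) = y" if "y \<in> inverse_limit_carrier H q" for y
    using that eg(2) by (fastforce simp: E_def E'_def inverse_limit_carrier_def PiE_iff extensional_def)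
  ultimately have "homeomorphic_maps (topo (inverse_limit G p)) (topo (inverse_limit H q)) E E'"
    unfolding homeomorphic_maps_def using E_cont E'_cont topG topH by simp
  then have "homeomorphic_map (topo (inverse_limit G p)) (topo (inverse_limit H q)) E"
    by (rule homeomorphic_maps_imp_map)
  moreover have "E \<in> top_hom (inverse_limit G p) (inverse_limit H q)"
  proof (rule top_homI[OF _ _ _ E_cont])
    fix x assume x: "x \<in> carrier (inverse_limit G p)"
    then show "E x \<in> carrier (inverse_limit H q)" using E by simp
    fix y assume y: "y \<in> carrier (inverse_limit G p)"
    have "x n \<in> carrier (G n)" "y n \<in> carrier (G n)" if "1 \<le> n" for n
      using x y that by (auto simp: inverse_limit_carrier_def PiE_iff)
    then show "E (x \<otimes>\<^bsub>inverse_limit G p\<^esub> y) = E x \<otimes>\<^bsub>inverse_limit H q\<^esub> E y"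
      using hom(2) by (auto simp: E_def)
  next
    show "E \<one>\<^bsub>inverse_limit G p\<^esub> = \<one>\<^bsub>inverse_limit H q\<^esub>"
      using hom(3) by (auto simp: E_def)
  qed
  ultimately have "E \<in> top_iso (inverse_limit G p) (inverse_limit H q)"
    using topG topH by (intro top_isoI) simp_all
  then show ?thesis by (simp add: E_def)
qed

section \<open>Sequences and lattice sets as topological monoids\<close>

lemma seq_monoid_simps [simp]:
  "carrier seq_monoid = (\<Pi>\<^sub>E j\<in>{1..}. UNIV)"
  "a \<otimes>\<^bsub>seq_monoid\<^esub> b = (\<lambda>j\<in>{1..}. a j + b j)"
  "\<one>\<^bsub>seq_monoid\<^esub> = (\<lambda>j\<in>{1..}. 0)"
  "topo seq_monoid = product_topology (\<lambda>j. discrete_topology UNIV) {1..}"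
  by (simp_all add: seq_monoid_def)

lemma lattice_monoid_simps [simp]:
  "carrier lattice_monoid = lattice_sets"
  "x \<otimes>\<^bsub>lattice_monoid\<^esub> y = x + y"
  "\<one>\<^bsub>lattice_monoid\<^esub> = quadrant"
  by (simp_all add: lattice_monoid_def)

lemma topspace_seq_monoid: "topspace (topo seq_monoid) = carrier seq_monoid"
  by simp

lemma topspace_lattice_monoid: "topspace (topo lattice_monoid) = carrier lattice_monoid"
  by (simp add: lattice_monoid_def topspace_pullback_topology)

lemma top_comm_monoid_seq: "top_comm_monoid seq_monoid"
proof -
  have "comm_monoid seq_monoid"
    by (rule comm_monoidI) (auto simp: PiE_iff extensional_def fun_eq_iff)
  moreover have "continuous_map (prod_topology (topo seq_monoid) (topo seq_monoid)) (topo seq_monoid)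
      (\<lambda>(a, b). a \<otimes>\<^bsub>seq_monoid\<^esub> b)"
    unfolding seq_monoid_simps(4) continuous_map_componentwise
  proof (intro conjI ballI)
    fix j :: nat assume j: "j \<in> {1..}"
    let ?X = "product_topology (\<lambda>j. discrete_topology (UNIV :: nat set)) {1::nat..}"
    have "continuous_map (prod_topology ?X ?X)
        (prod_topology (discrete_topology UNIV) (discrete_topology UNIV)) (\<lambda>(a, b). (a j, b j))"
      using continuous_map_product_projection[OF j, of "\<lambda>j. discrete_topology (UNIV :: nat set)"]
      by (simp add: continuous_map_prod_top)
    moreover have "continuous_map (prod_topology (discrete_topology UNIV) (discrete_topology UNIV))
        (discrete_topology UNIV) (\<lambda>(m, n). m + n :: nat)"
      by (simp add: prod_topology_discrete_topology[symmetric])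
    ultimately have "continuous_map (prod_topology ?X ?X) (discrete_topology UNIV)
        ((\<lambda>(m, n). m + n) \<circ> (\<lambda>(a, b). (a j, b j)))"
      by (rule continuous_map_compose)
    then show "continuous_map (prod_topology ?X ?X) (discrete_topology UNIV)
        (\<lambda>x. (case x of (a, b) \<Rightarrow> a \<otimes>\<^bsub>seq_monoid\<^esub> b) j)"
      by (rule continuous_map_eq) (use j in auto)
  qed auto
  ultimately show ?thesis
    unfolding top_comm_monoid_def top_comm_monoid_axioms_def using topspace_seq_monoid by blast
qed

text \<open>The sequences sharing the first \<open>n\<close> entries with a given one form a basic open set, on which
\<open>f\<close> is constant.\<close>

lemma finitely_determined_continuous:
  assumes "\<And>a b. a \<in> carrier seq_monoid \<Longrightarrow> b \<in> carrier seq_monoid \<Longrightarrow>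
      (\<And>j. 1 \<le> j \<Longrightarrow> j \<le> n \<Longrightarrow> a j = b j) \<Longrightarrow> f a = f b"
  shows "continuous_map (topo seq_monoid) (discrete_topology UNIV) f"
  unfolding continuous_map_def
proof (intro conjI allI impI)
  fix U :: "'a set"
  show "openin (topo seq_monoid) {a \<in> topspace (topo seq_monoid). f a \<in> U}"
  proof (subst openin_subopen, rule ballI)
    fix a assume a: "a \<in> {a \<in> topspace (topo seq_monoid). f a \<in> U}"
    define T where "T = (\<Pi>\<^sub>E j\<in>{1..}. if j \<le> n then {a j} else UNIV)"
    have "{j. (if j \<le> n then {a j} else UNIV) \<noteq> topspace (discrete_topology (UNIV :: nat set))}
        \<subseteq> {..n}" by auto
    then have "openin (topo seq_monoid) T"
      unfolding T_def seq_monoid_simps(4) by (intro product_topology_basis) (auto intro: finite_subset)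
    moreover have "a \<in> T" using a by (auto simp: T_def PiE_iff)
    moreover have "T \<subseteq> {a \<in> topspace (topo seq_monoid). f a \<in> U}"
    proof
      fix b assume b: "b \<in> T"
      have b_mem: "b \<in> carrier seq_monoid" using b by (auto simp: T_def PiE_iff)
      have "b j = a j" if "1 \<le> j" "j \<le> n" for j
        using that PiE_mem[OF b[unfolded T_def], of j] by simp
      then have "f b = f a" using a b_mem by (intro assms) auto
      then show "b \<in> {a \<in> topspace (topo seq_monoid). f a \<in> U}" using a b_mem by simp
    qed
    ultimately show "\<exists>T. openin (topo seq_monoid) T \<and> a \<in> T \<and> T \<subseteq> {a \<in> topspace (topo seq_monoid). f a \<in> U}"
      by blast
  qed
qed auto

lemma openin_lattice_membership:
  "openin (topo lattice_monoid) {L \<in> lattice_sets. u \<in> L}"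
  "openin (topo lattice_monoid) {L \<in> lattice_sets. u \<notin> L}"
proof -
  let ?Y = "product_topology (\<lambda>_. discrete_topology (UNIV :: int set)) (UNIV :: (int \<times> int) set)"
  have "openin (topo lattice_monoid) {L \<in> lattice_sets. (indicator L u :: int) \<in> V}" for V
  proof -
    have "openin ?Y {f \<in> topspace ?Y. f u \<in> V}"
      by (rule openin_continuous_map_preimage[OF continuous_map_product_projection]) auto
    moreover have "{L \<in> lattice_sets. (indicator L u :: int) \<in> V}
        = (\<lambda>L. indicator L) -` {f \<in> topspace ?Y. f u \<in> V} \<inter> lattice_sets" by auto
    ultimately show ?thesis
      unfolding lattice_monoid_def by (auto simp: openin_pullback_topology)
  qed
  from this[of "{1}"] this[of "{0}"]
  show "openin (topo lattice_monoid) {L \<in> lattice_sets. u \<in> L}"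
    "openin (topo lattice_monoid) {L \<in> lattice_sets. u \<notin> L}"
    by (simp_all add: indicator_eq_1_iff indicator_eq_0_iff)
qed

lemma slope_set_zero: "slope_set (\<lambda>j\<in>{1..}. 0) = quadrant"
proof (intro equalityI quadrant_subset_slope_set subsetI)
  fix u assume u: "u \<in> slope_set (\<lambda>j\<in>{1..}. 0)"
  obtain x y where xy: "u = (x, y)" by fastforce
  have zero: "descent (\<lambda>j\<in>{1..}. 0) k = 0" for k by (simp add: descent_def)
  from u[unfolded xy] show "u \<in> quadrant"
    by (cases rule: slope_set_cases) (use zero xy in \<open>auto simp: quadrant_def\<close>)
qed

lemma slope_set_surj: "slope_set ` carrier seq_monoid = lattice_sets"
proof (intro equalityI subsetI)
  fix L assume "L \<in> lattice_sets"
  then obtain a where "a \<in> carrier seq_monoid" "L = slope_set a"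
    using ex_slope_set_of_lattice_set by (metis seq_monoid_simps(1))
  then show "L \<in> slope_set ` carrier seq_monoid" by blast
qed (auto simp: slope_set_in_lattice_sets)

lemma slope_set_inj: "inj_on slope_set (carrier seq_monoid)"
proof (rule inj_onI)
  fix a b assume ab: "a \<in> carrier seq_monoid" "b \<in> carrier seq_monoid" and eq: "slope_set a = slope_set b"
  show "a = b"
  proof (rule PiE_ext[OF ab[unfolded seq_monoid_simps]])
    fix j :: nat assume "j \<in> {1..}"
    then show "a j = b j"
      using slope_set_determines_seq[of j a b j] vertex_mem past_vertex_not_mem eq by (metis atLeast_iff order_refl)
  qed
qed

lemma slope_set_continuous: "continuous_map (topo seq_monoid) (topo lattice_monoid) slope_set"
proof -
  have "continuous_map (topo seq_monoid) (product_topology (\<lambda>_. discrete_topology UNIV) UNIV)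
      ((\<lambda>L. indicator L :: int \<times> int \<Rightarrow> int) \<circ> slope_set)"
    unfolding continuous_map_componentwise_UNIV
  proof
    fix u :: "int \<times> int"
    obtain x y where xy: "u = (x, y)" by fastforce
    show "continuous_map (topo seq_monoid) (discrete_topology UNIV)
        (\<lambda>a. ((\<lambda>L. indicator L :: int \<times> int \<Rightarrow> int) \<circ> slope_set) a u)"
    proof (rule finitely_determined_continuous[where n = "nat x"])
      fix a b :: "nat \<Rightarrow> nat" assume "\<And>j. 1 \<le> j \<Longrightarrow> j \<le> nat x \<Longrightarrow> a j = b j"
      then have "(x, y) \<in> slope_set a \<longleftrightarrow> (x, y) \<in> slope_set b" by (rule slope_set_local)
      then show "((\<lambda>L. indicator L :: int \<times> int \<Rightarrow> int) \<circ> slope_set) a u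
          = ((\<lambda>L. indicator L) \<circ> slope_set) b u"
        by (simp add: xy indicator_def)
    qed
  qed
  then have "continuous_map (topo seq_monoid)
      (pullback_topology lattice_sets (\<lambda>L. indicator L :: int \<times> int \<Rightarrow> int)
        (product_topology (\<lambda>_. discrete_topology UNIV) UNIV)) slope_set"
    by (rule continuous_map_pullback') (auto simp: slope_set_in_lattice_sets)
  then show ?thesis by (simp add: lattice_monoid_def)
qed

text \<open>By \<open>slope_set_determines_seq\<close>, the lattice sets that agree with \<open>L = slope_set a\<close> on the relevant
\<open>2 (j + 1)\<close> points form an open neighbourhood of \<open>L\<close> on which the \<open>j\<close>-th entry is
constant.\<close>

lemma slope_set_inverse_continuous:
  assumes g: "\<And>a. a \<in> carrier seq_monoid \<Longrightarrow> g (slope_set a) = a"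
  shows "continuous_map (topo lattice_monoid) (topo seq_monoid) g"
  unfolding seq_monoid_simps(4) continuous_map_componentwise
proof (intro conjI ballI)
  have "g L \<in> carrier seq_monoid" if "L \<in> lattice_sets" for L
    using that g slope_set_surj by (metis imageE)
  then show "g ` topspace (topo lattice_monoid) \<subseteq> extensional {1..}"
    unfolding topspace_lattice_monoid by (auto simp: PiE_iff)
next
  fix j :: nat assume j: "j \<in> {1..}"
  show "continuous_map (topo lattice_monoid) (discrete_topology UNIV) (\<lambda>L. g L j)"
    unfolding continuous_map_def
  proof (intro conjI allI impI)
    fix U :: "nat set"
    show "openin (topo lattice_monoid) {L \<in> topspace (topo lattice_monoid). g L j \<in> U}"
    proof (subst openin_subopen, rule ballI)
      fix L assume L: "L \<in> {L \<in> topspace (topo lattice_monoid). g L j \<in> U}"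
      then have "L \<in> slope_set ` carrier seq_monoid"
        unfolding slope_set_surj topspace_lattice_monoid by simp
      then obtain a where a: "a \<in> carrier seq_monoid" "L = slope_set a" by blast
      define T where "T = (\<Inter>k\<in>{..j}.
        {M \<in> lattice_sets. (vertex_abscissa a k, - int (descent a k)) \<in> M} \<inter>
        {M \<in> lattice_sets. (vertex_abscissa a k + int k, - int (Suc (descent a k))) \<notin> M})"
      have "openin (topo lattice_monoid) T"
        unfolding T_def by (intro openin_INT2 openin_Int openin_lattice_membership) auto
      moreover have "L \<in> T"
        unfolding T_def a(2) using slope_set_in_lattice_sets vertex_mem past_vertex_not_mem by blast
      moreover have "T \<subseteq> {L \<in> topspace (topo lattice_monoid). g L j \<in> U}"
      proof
        fix M assume M: "M \<in> T"
        then have M_mem: "M \<in> lattice_sets" unfolding T_def by blast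
        then obtain b where b: "b \<in> carrier seq_monoid" "M = slope_set b"
          using slope_set_surj by blast
        have "b j = a j"
          by (rule slope_set_determines_seq[where n = j]) (use M b j in \<open>auto simp: T_def\<close>)
        then have "g M j = g L j" using g a b by simp
        then show "M \<in> {L \<in> topspace (topo lattice_monoid). g L j \<in> U}"
          using L M_mem topspace_lattice_monoid by simp
      qed
      ultimately show "\<exists>T. openin (topo lattice_monoid) T \<and> L \<in> T \<and>
          T \<subseteq> {L \<in> topspace (topo lattice_monoid). g L j \<in> U}" by blast
    qed
  qed auto
qed

lemma slope_set_top_iso: "slope_set \<in> top_iso seq_monoid lattice_monoid"
proof (rule top_isoI)
  show "slope_set \<in> top_hom seq_monoid lattice_monoid"
    by (rule top_homI)
      (use slope_set_in_lattice_sets slope_set_add slope_set_zero slope_set_continuous in auto)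
  define g where "g = inv_into (carrier seq_monoid) slope_set"
  have g: "g (slope_set a) = a" if "a \<in> carrier seq_monoid" for a
    unfolding g_def using slope_set_inj that by (rule inv_into_f_f)
  have "slope_set (g L) = L" if "L \<in> lattice_sets" for L
    unfolding g_def using f_inv_into_f[of L slope_set "carrier seq_monoid"] that slope_set_surj by simp
  then have "homeomorphic_maps (topo seq_monoid) (topo lattice_monoid) slope_set g"
    unfolding homeomorphic_maps_def topspace_seq_monoid topspace_lattice_monoid
    using slope_set_continuous slope_set_inverse_continuous g by simp
  then show "homeomorphic_map (topo seq_monoid) (topo lattice_monoid) slope_set"
    by (rule homeomorphic_maps_imp_map)
qed (rule topspace_seq_monoid topspace_lattice_monoid)+

lemma top_comm_monoid_lattice: "top_comm_monoid lattice_monoid"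
  using top_comm_monoid_seq slope_set_top_iso by (rule top_comm_monoid_transport)

lemma Hausdorff_lattice_monoid: "Hausdorff_space (topo lattice_monoid)"
proof -
  have "Hausdorff_space (topo seq_monoid)"
    by (simp add: Hausdorff_space_product_topology)
  moreover have "topo seq_monoid homeomorphic_space topo lattice_monoid"
    using top_isoD(3)[OF slope_set_top_iso] homeomorphic_map_imp_homeomorphic_space by blast
  ultimately show ?thesis using homeomorphic_Hausdorff_space by blast
qed


section \<open>The limit defining the isomorphism\<close>

lemma truncation_in_carrier: "truncation n a \<in> carrier seq_monoid"
  by (simp add: truncation_def)

lemma F_gen_eq_slope_set:
  assumes "1 \<le> j"
  shows "F_gen j = slope_set (\<lambda>i. if i = j then 1 else 0)"
proof -
  let ?d = "\<lambda>i. if i = j then 1 else 0 :: nat"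
  have desc: "descent ?d k = (if j \<le> k then 1 else 0)" for k
    using assms by (auto simp: descent_def)
  have supp: "support ?d j = 0"
    by (simp add: support_def desc)
  obtain i where i: "j = Suc i" using assms by (cases j) auto
  show ?thesis
  proof (intro equalityI subsetI)
    fix u assume "u \<in> F_gen j"
    moreover have "(int j, - 1) \<in> slope_set ?d"
      using edge_point_mem[of ?d i 1 "int j"] desc supp i by simp
    then have "{(int j, - 1)} + quadrant \<subseteq> slope_set ?d"
      using monoid_submodule_slope_set[of ?d] set_plus_mono2[of "{(int j, - 1)}" "slope_set ?d" quadrant quadrant]
      unfolding monoid_submodule_def by blast
    ultimately show "u \<in> slope_set ?d"
      using quadrant_subset_slope_set[of ?d] unfolding F_gen_def by blast
  next
    fix u assume u: "u \<in> slope_set ?d"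
    obtain x y where xy: "u = (x, y)" by fastforce
    from u[unfolded xy] show "u \<in> F_gen j"
    proof (cases rule: slope_set_cases)
      case 1
      then show ?thesis by (simp add: F_gen_def quadrant_def xy)
    next
      case (2 l h)
      then have "Suc l = j" "h = 1" by (auto simp: desc split: if_splits)
      then have "(int j, - 1) + (x - int j, 0) = u" "(x - int j, 0) \<in> quadrant"
        using 2 supp xy by (auto simp: quadrant_def)
      then have "u \<in> {(int j, - 1)} + quadrant" by (metis set_plus_intro singletonI)
      then show ?thesis by (simp add: F_gen_def)
    qed
  qed
qed

text \<open>Partial sums of multiples of generators are computed in the sequence monoid, where the generators are
the unit vectors.\<close>

lemma eta_partial_eq: "eta_partial a N = slope_set (truncation N a)"
proof -
  interpret L: top_comm_monoid lattice_monoid by (rule top_comm_monoid_lattice)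
  have pow: "F_gen j [^]\<^bsub>lattice_monoid\<^esub> m = slope_set (\<lambda>i. if i = j then m else 0)" if "1 \<le> j"
    for j m
  proof (induction m)
    case 0
    have "slope_set (\<lambda>i. 0) = quadrant" using slope_set_zero by simp
    then show ?case by simp
  next
    case (Suc m)
    have "(\<lambda>i. (if i = j then m else 0) + (if i = j then 1 else 0)) = (\<lambda>i. if i = j then Suc m else 0)"
      by auto
    then show ?case using Suc F_gen_eq_slope_set[OF that] by (simp add: slope_set_add)
  qed
  show ?thesis
  proof (induction N)
    case 0
    have "truncation 0 a = (\<lambda>j\<in>{1..}. 0)" by (auto simp: truncation_def)
    then show ?case using slope_set_zero by (simp only: eta_partial_def) simp
  next
    case (Suc N)
    have "eta_partial a (Suc N) = finprod lattice_monoid (\<lambda>j. F_gen j [^]\<^bsub>lattice_monoid\<^esub> a j) (insert (Suc N) {1..N})"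
      by (simp add: eta_partial_def atLeastAtMostSuc_conv)
    also have "\<dots> = F_gen (Suc N) [^]\<^bsub>lattice_monoid\<^esub> a (Suc N) + eta_partial a N"
      unfolding eta_partial_def
      by (subst L.finprod_insert) (auto simp: pow slope_set_in_lattice_sets)
    also have "\<dots> = slope_set (\<lambda>i. (if i = Suc N then a (Suc N) else 0) + truncation N a i)"
      by (simp add: pow Suc slope_set_add)
    also have "\<dots> = slope_set (restrict (\<lambda>i. (if i = Suc N then a (Suc N) else 0) + truncation N a i) {Suc 0..})"
      by simp
    also have "restrict (\<lambda>i. (if i = Suc N then a (Suc N) else 0) + truncation N a i) {Suc 0..}
        = truncation (Suc N) a"
      by (rule ext) (auto simp: truncation_def restrict_def le_Suc_eq)
    finally show ?case .
  qed
qed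

text \<open>Truncations converge to the sequence and \<open>slope_set\<close> is continuous; the limit is unique as the
space of lattice sets, being homeomorphic to a product of discrete spaces, is Hausdorff.\<close>

lemma eta_eq:
  assumes "a \<in> carrier seq_monoid"
  shows "eta a = slope_set a"
proof -
  have "limitin (topo seq_monoid) (\<lambda>N. truncation N a) a sequentially"
    unfolding seq_monoid_simps(4) limitin_componentwise
  proof (intro conjI ballI)
    show "a \<in> extensional {1..}" using assms by (simp add: PiE_iff)
    show "\<forall>\<^sub>F N in sequentially. truncation N a
        \<in> topspace (product_topology (\<lambda>j. discrete_topology UNIV) {1..})"
      using truncation_in_carrier by simp
    fix j :: nat assume "j \<in> {1..}"
    then have "\<forall>\<^sub>F N in sequentially. truncation N a j = a j"
      unfolding eventually_sequentially by (auto simp: truncation_def)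
    then show "limitin (discrete_topology UNIV) (\<lambda>N. truncation N a j) (a j) sequentially"
      by (intro limitin_eventually) auto
  qed
  then have "limitin (topo lattice_monoid) (slope_set \<circ> (\<lambda>N. truncation N a)) (slope_set a) sequentially"
    by (rule continuous_map_limit[OF slope_set_continuous])
  then have lim: "limitin (topo lattice_monoid) (eta_partial a) (slope_set a) sequentially"
    by (simp add: o_def eta_partial_eq[symmetric])
  show ?thesis
    unfolding eta_def
  proof (rule the_equality, rule lim)
    fix L assume "limitin (topo lattice_monoid) (eta_partial a) L sequentially"
    then show "L = slope_set a"
      using lim trivial_limit_sequentially Hausdorff_lattice_monoid by (rule limitin_Hausdorff_unique)
  qed
qed


section \<open>Restriction corresponds to truncation\<close>

lemma descent_truncation: "descent (truncation n a) k = min (descent a k) (descent a n)"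
proof (induction k)
  case (Suc k)
  then show ?case
    using descent_mono[of k n a] descent_mono[of "Suc k" n a] descent_mono[of n k a]
    by (cases "Suc k \<le> n") (auto simp: truncation_def min_def)
qed simp

text \<open>The set cut at \<open>c\<close> is the slope set of a sequence \<open>b c\<close>. If no slope above \<open>n\<close> occurs then
all cuts are admissible, and there is no largest one. Otherwise, a cut at \<open>c\<close> is admissible iff
it stays above the first edge of slope greater than \<open>n\<close>, that is, iff \<open>c \<le> descent a n\<close>.\<close>

lemma rho_slope_set: "rho n (slope_set a) = slope_set (truncation n a)"
proof -
  define b where "b c = (\<lambda>j. min (descent a j) c - min (descent a (j - 1)) c)" for c
  have desc_b: "descent (b c) k = min (descent a k) c" for c k
    by (induction k) (auto simp: b_def min_def)
  have adm: "admissible_cut n (slope_set a) c \<longleftrightarrow> (\<forall>k>n. b c k = 0)" for c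
    by (rule admissible_cut_iff[OF cut_slope_set[OF desc_b]])
  show ?thesis
  proof (cases "\<forall>j>n. a j = 0")
    case True
    have const: "descent a k = descent a n" if "n \<le> k" for k
      using that by (induction k rule: dec_induct) (auto simp: True)
    have "admissible_cut n (slope_set a) c" for c
      unfolding adm b_def
    proof (intro allI impI)
      fix k assume "n < k"
      then show "min (descent a k) c - min (descent a (k - 1)) c = 0"
        using const[of k] const[of "k - 1"] by simp
    qed
    then have "\<not> (\<exists>c. admissible_cut n (slope_set a) c \<and> (\<forall>c'. admissible_cut n (slope_set a) c' \<longrightarrow> c' \<le> c))"
      using Suc_n_not_le_n by blast
    then have "rho n (slope_set a) = slope_set a" unfolding rho_def by (rule if_not_P)
    also have "\<dots> = slope_set (truncation n a)"
    proof -
      have "descent a k = descent (truncation n a) k" for k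
        unfolding descent_truncation using const[of k] descent_mono[of k n a] by (cases "n \<le> k") auto
      then have "support a k = support (truncation n a) k" for k by (intro support_cong)
      then show ?thesis by (simp add: slope_set_def)
    qed
    finally show ?thesis .
  next
    case False
    then obtain j where j: "n < j" "a j \<noteq> 0" by blast
    obtain i where i: "j = Suc i" using j by (cases j) auto
    have "descent a n < descent a j"
      using descent_mono[of n i a] j i by simp
    have adm_iff: "admissible_cut n (slope_set a) c \<longleftrightarrow> c \<le> descent a n" for c
    proof
      assume c: "c \<le> descent a n"
      have "min (descent a k) c = c" if "n \<le> k" for k
        using c descent_mono[OF that, of a] by simp
      then show "admissible_cut n (slope_set a) c" unfolding adm b_def by simp
    next
      assume "admissible_cut n (slope_set a) c"
      then have zero: "b c k = 0" if "n < k" for k using adm that by blast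
      have "descent (b c) k = descent (b c) n" if "n \<le> k" for k
        using that by (induction k rule: dec_induct) (auto simp: zero)
      from this[of j] show "c \<le> descent a n"
        using \<open>descent a n < descent a j\<close> j unfolding desc_b by (simp add: min_def split: if_splits)
    qed
    then have "\<exists>c. admissible_cut n (slope_set a) c \<and> (\<forall>c'. admissible_cut n (slope_set a) c' \<longrightarrow> c' \<le> c)"
      by blast
    moreover have "(GREATEST c. admissible_cut n (slope_set a) c) = descent a n"
      unfolding adm_iff by (rule Greatest_equality) auto
    ultimately have "rho n (slope_set a) = cut (slope_set a) (descent a n)" unfolding rho_def by simp
    also have "\<dots> = slope_set (truncation n a)"
      by (rule cut_slope_set) (rule descent_truncation)
    finally show ?thesis .
  qed
qed


section \<open>The inverse systems and their limits\<close>

definition seqs_upto :: "nat \<Rightarrow> (nat \<Rightarrow> nat) set" where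
  "seqs_upto n = {a \<in> carrier seq_monoid. \<forall>j>n. a j = 0}"

lemma seq_monoid_upto_eq: "seq_monoid_upto n = top_submonoid seq_monoid (seqs_upto n)"
  by (simp add: seq_monoid_upto_def top_submonoid_def seqs_upto_def Let_def)

lemma lattice_monoid_upto_eq:
  "lattice_monoid_upto n = top_submonoid lattice_monoid (lattice_sets_upto n)"
  by (simp add: lattice_monoid_upto_def top_submonoid_def)

lemma seqs_upto_subset: "seqs_upto n \<subseteq> carrier seq_monoid"
  by (auto simp: seqs_upto_def)

lemma top_comm_monoid_seq_upto: "top_comm_monoid (seq_monoid_upto n)"
  unfolding seq_monoid_upto_eq
  by (rule top_comm_monoid_submonoid[OF top_comm_monoid_seq seqs_upto_subset])
    (auto simp: seqs_upto_def)

lemma slope_set_image_upto: "slope_set ` seqs_upto n = lattice_sets_upto n"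
proof (intro equalityI subsetI)
  fix L assume "L \<in> lattice_sets_upto n"
  moreover then obtain a where "a \<in> carrier seq_monoid" "L = slope_set a"
    using ex_slope_set_of_lattice_set[of L] by (auto simp: lattice_sets_upto_def)
  ultimately show "L \<in> slope_set ` seqs_upto n"
    using slope_set_in_lattice_sets_upto_iff by (auto simp: seqs_upto_def)
qed (auto simp: seqs_upto_def slope_set_in_lattice_sets_upto_iff)

lemma slope_set_top_iso_upto: "slope_set \<in> top_iso (seq_monoid_upto n) (lattice_monoid_upto n)"
  unfolding seq_monoid_upto_eq lattice_monoid_upto_eq
  by (rule top_iso_submonoid[OF topspace_seq_monoid topspace_lattice_monoid slope_set_top_iso
        seqs_upto_subset slope_set_image_upto])

lemma truncation_in_seqs_upto: "truncation n a \<in> seqs_upto n"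
  by (simp add: seqs_upto_def truncation_def)

lemma truncation_id: "a \<in> seqs_upto n \<Longrightarrow> truncation n a = a"
  by (auto simp: seqs_upto_def truncation_def PiE_iff extensional_def fun_eq_iff not_le)

lemma truncation_truncation: "m \<le> n \<Longrightarrow> truncation m (truncation n a) = truncation m a"
  by (auto simp: truncation_def)

lemma truncation_top_hom: "truncation n \<in> top_hom seq_monoid seq_monoid"
proof (rule top_homI)
  show "continuous_map (topo seq_monoid) (topo seq_monoid) (truncation n)"
    unfolding seq_monoid_simps(4) continuous_map_componentwise
  proof (intro conjI ballI)
    fix j :: nat assume "j \<in> {1..}"
    then show "continuous_map (product_topology (\<lambda>j. discrete_topology UNIV) {1..}) (discrete_topology UNIV)
        (\<lambda>a. truncation n a j)"
      using continuous_map_product_projection[of j "{1..}" "\<lambda>j. discrete_topology (UNIV :: nat set)"]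
      by (cases "j \<le> n") (simp_all add: truncation_def)
  qed (auto simp: truncation_def)
qed (auto simp: truncation_def)

lemma truncation_top_epi: "truncation n \<in> top_epi seq_monoid (seq_monoid_upto n)"
proof -
  have "truncation n \<in> top_hom (top_submonoid seq_monoid (carrier seq_monoid)) (seq_monoid_upto n)"
    unfolding seq_monoid_upto_eq
    by (rule top_hom_submonoid[OF truncation_top_hom]) (auto simp: truncation_in_seqs_upto)
  moreover have "top_submonoid seq_monoid (carrier seq_monoid) = seq_monoid"
  proof -
    have "subtopology (topo seq_monoid) (carrier seq_monoid) = topo seq_monoid"
      using subtopology_topspace[of "topo seq_monoid"] unfolding topspace_seq_monoid .
    then show ?thesis unfolding top_submonoid_def by (simp del: seq_monoid_simps)
  qed
  moreover have "truncation n ` carrier seq_monoid = seqs_upto n"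
  proof (intro equalityI subsetI)
    fix a assume "a \<in> seqs_upto n"
    then show "a \<in> truncation n ` carrier seq_monoid"
      using truncation_id[of a n] seqs_upto_subset[of n] by (intro image_eqI[of _ _ a]) auto
  qed (use truncation_in_seqs_upto in blast)
  ultimately show ?thesis by (simp add: top_epi_def seq_monoid_upto_eq)
qed

lemma truncation_top_epi_upto: "truncation n \<in> top_epi (seq_monoid_upto (Suc n)) (seq_monoid_upto n)"
proof -
  have "truncation n \<in> top_hom (seq_monoid_upto (Suc n)) (seq_monoid_upto n)"
    unfolding seq_monoid_upto_eq
    by (rule top_hom_submonoid[OF truncation_top_hom seqs_upto_subset]) (rule truncation_in_seqs_upto)
  moreover have "a \<in> truncation n ` seqs_upto (Suc n)" if "a \<in> seqs_upto n" for a
    using that truncation_id[OF that] by (intro image_eqI[of _ _ a]) (auto simp: seqs_upto_def)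
  ultimately show ?thesis
    using truncation_in_seqs_upto by (auto simp: top_epi_def seq_monoid_upto_eq)
qed

lemma rho_top_epi: "rho n \<in> top_epi lattice_monoid (lattice_monoid_upto n)"
  by (rule top_epi_conjugate[OF top_comm_monoid_seq slope_set_top_iso slope_set_top_iso_upto
        truncation_top_epi]) (rule rho_slope_set)

lemma rho_top_epi_upto:
  "rho n \<in> top_epi (lattice_monoid_upto (Suc n)) (lattice_monoid_upto n)"
  by (rule top_epi_conjugate[OF top_comm_monoid_seq_upto slope_set_top_iso_upto slope_set_top_iso_upto
        truncation_top_epi_upto]) (rule rho_slope_set)

lemma topspace_seq_monoid_upto: "topspace (topo (seq_monoid_upto n)) = carrier (seq_monoid_upto n)"
  using seqs_upto_subset[of n] by (auto simp: seq_monoid_upto_eq)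

lemma topspace_lattice_monoid_upto:
  "topspace (topo (lattice_monoid_upto n)) = carrier (lattice_monoid_upto n)"
  using topspace_lattice_monoid by (auto simp: lattice_monoid_upto_eq lattice_sets_upto_def)

lemma inverse_limit_seq_truncation:
  assumes x: "x \<in> inverse_limit_carrier seq_monoid_upto truncation" and "m \<le> n" "1 \<le> m"
  shows "truncation m (x n) = x m"
  using \<open>m \<le> n\<close>
proof (induction n rule: dec_induct)
  case base
  have "x m \<in> seqs_upto m" using x \<open>1 \<le> m\<close>
    by (auto simp: inverse_limit_carrier_def PiE_iff seq_monoid_upto_eq)
  then show ?case by (rule truncation_id)
next
  case (step n)
  have "truncation n (x (Suc n)) = x n"
    using x step.hyps \<open>1 \<le> m\<close> by (auto simp: inverse_limit_carrier_def)
  then show ?case using step truncation_truncation[of m n "x (Suc n)"] by simp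
qed

text \<open>The inverse takes the diagonal \<open>\<lambda>j. x j j\<close>: the entry \<open>j\<close> of a sequence is
unaffected by truncation at \<open>j\<close> and beyond.\<close>

lemma truncations_top_iso:
  "(\<lambda>a. \<lambda>n\<in>{1..}. truncation n a) \<in> top_iso seq_monoid (inverse_limit seq_monoid_upto truncation)"
proof -
  let ?L = "inverse_limit seq_monoid_upto truncation"
  define f where "f = (\<lambda>a. \<lambda>n\<in>{1::nat..}. truncation n a)"
  define g where "g = (\<lambda>x :: nat \<Rightarrow> nat \<Rightarrow> nat. \<lambda>j\<in>{1::nat..}. x j j)"
  have top: "topspace (topo ?L) = inverse_limit_carrier seq_monoid_upto truncation"
    by (rule topspace_inverse_limit) (rule topspace_seq_monoid_upto)
  have f_mem: "f a \<in> inverse_limit_carrier seq_monoid_upto truncation" for a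
    by (auto simp: f_def inverse_limit_carrier_def seq_monoid_upto_eq truncation_in_seqs_upto
        truncation_truncation)
  have f_cont: "continuous_map (topo seq_monoid) (topo ?L) f"
  proof (rule continuous_map_into_inverse_limit[OF f_mem])
    fix n :: nat assume "1 \<le> n"
    then show "continuous_map (topo seq_monoid) (topo (seq_monoid_upto n)) (\<lambda>a. f a n)"
      using truncation_top_epi[of n] by (simp add: f_def top_epi_def top_hom_def)
  qed
  have g_cont: "continuous_map (topo ?L) (topo seq_monoid) g"
    unfolding seq_monoid_simps(4) continuous_map_componentwise
  proof (intro conjI ballI)
    fix j :: nat assume j: "j \<in> {1..}"
    have "continuous_map (topo (seq_monoid_upto j)) (discrete_topology UNIV) (\<lambda>a. a j)"
      unfolding seq_monoid_upto_eq top_submonoid_simps seq_monoid_simps(4)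
      using continuous_map_product_projection[OF j, of "\<lambda>j. discrete_topology UNIV"]
      by (rule continuous_map_from_subtopology)
    then have "continuous_map (topo ?L) (discrete_topology UNIV) ((\<lambda>a. a j) \<circ> (\<lambda>x. x j))"
      using j by (intro continuous_map_compose[OF inverse_limit_component_continuous]) auto
    then show "continuous_map (topo ?L) (discrete_topology UNIV) (\<lambda>x. g x j)"
      using j by (simp add: g_def o_def)
  qed (auto simp: g_def)
  have "g (f a) = a" if "a \<in> carrier seq_monoid" for a
    using that by (auto simp: f_def g_def truncation_def PiE_iff extensional_def fun_eq_iff)
  moreover have "f (g x) = x" if x: "x \<in> inverse_limit_carrier seq_monoid_upto truncation" for x
  proof
    fix n
    show "f (g x) n = x n"
    proof (cases "1 \<le> n")
      case True
      have xn: "x n \<in> seqs_upto n" using x True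
        by (auto simp: inverse_limit_carrier_def PiE_iff seq_monoid_upto_eq)
      have "truncation n (g x) j = x n j" for j
      proof (cases "1 \<le> j \<and> j \<le> n")
        case True
        then have "truncation j (x n) j = x j j" using inverse_limit_seq_truncation[OF x] by simp
        then show ?thesis using True by (simp add: truncation_def g_def)
      next
        case False
        then show ?thesis
          using fun_cong[OF truncation_id[OF xn], of j] by (auto simp: truncation_def split: if_splits)
      qed
      then show ?thesis using True by (auto simp: f_def)
    next
      case False
      then show ?thesis using x by (auto simp: f_def inverse_limit_carrier_def PiE_iff extensional_def)
    qed
  qed
  ultimately have "homeomorphic_maps (topo seq_monoid) (topo ?L) f g"
    unfolding homeomorphic_maps_def topspace_seq_monoid top using f_cont g_cont by blast
  then have "homeomorphic_map (topo seq_monoid) (topo ?L) f" by (rule homeomorphic_maps_imp_map)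
  moreover have "f \<in> top_hom seq_monoid ?L"
  proof (rule top_homI[OF _ _ _ f_cont])
    show "f a \<in> carrier ?L" for a using f_mem by simp
    show "f (a \<otimes>\<^bsub>seq_monoid\<^esub> b) = f a \<otimes>\<^bsub>?L\<^esub> f b" for a b
      by (intro ext) (simp add: f_def truncation_def seq_monoid_upto_eq)
    show "f \<one>\<^bsub>seq_monoid\<^esub> = \<one>\<^bsub>?L\<^esub>"
      by (intro ext) (simp add: f_def truncation_def seq_monoid_upto_eq)
  qed
  ultimately have "f \<in> top_iso seq_monoid ?L"
    using topspace_seq_monoid top by (intro top_isoI) simp_all
  then show ?thesis by (simp only: f_def)
qed

lemma restrictions_top_iso:
  "(\<lambda>L. \<lambda>n\<in>{1..}. rho n L) \<in> top_iso lattice_monoid (inverse_limit lattice_monoid_upto rho)"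
proof (rule top_iso_conjugate[OF top_comm_monoid_seq slope_set_top_iso _ truncations_top_iso])
  show "(\<lambda>x. \<lambda>n\<in>{1..}. slope_set (x n)) \<in> top_iso (inverse_limit seq_monoid_upto truncation)
      (inverse_limit lattice_monoid_upto rho)"
    by (rule inverse_limit_top_iso)
      (simp_all only: slope_set_top_iso_upto topspace_seq_monoid_upto topspace_lattice_monoid_upto
        rho_slope_set, simp add: seq_monoid_upto_eq truncation_in_seqs_upto)
  show "(\<lambda>n\<in>{1..}. rho n (slope_set a)) = (\<lambda>n\<in>{1..}. slope_set ((\<lambda>n\<in>{1..}. truncation n a) n))" for a
    by (rule ext) (simp add: rho_slope_set)
qed

theorem theorem22:
  shows
    "top_comm_monoid seq_monoid \<and> top_comm_monoid lattice_monoid \<and>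
     surjective_inverse_system seq_monoid_upto truncation \<and>
     surjective_inverse_system lattice_monoid_upto rho \<and>
     (\<forall>n\<ge>1. truncation n \<in> top_epi seq_monoid (seq_monoid_upto n)) \<and>
     (\<forall>n\<ge>1. rho n \<in> top_epi lattice_monoid (lattice_monoid_upto n)) \<and>
     eta \<in> top_iso seq_monoid lattice_monoid \<and>
     (\<forall>n\<ge>1. eta \<in> top_iso (seq_monoid_upto n) (lattice_monoid_upto n)) \<and>
     (\<forall>n\<ge>1. \<forall>a\<in>carrier seq_monoid. truncation n (truncation (Suc n) a) = truncation n a) \<and>
     (\<forall>n\<ge>1. \<forall>L\<in>carrier lattice_monoid. rho n (rho (Suc n) L) = rho n L) \<and>
     (\<forall>n\<ge>1. \<forall>a\<in>carrier seq_monoid. eta (truncation n a) = rho n (eta a)) \<and>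
     (\<forall>n\<ge>1. \<forall>a\<in>carrier (seq_monoid_upto (Suc n)). eta (truncation n a) = rho n (eta a)) \<and>
     (\<lambda>L. \<lambda>n\<in>{1..}. rho n L) \<in> top_iso lattice_monoid (inverse_limit lattice_monoid_upto rho) \<and>
     (\<lambda>a. \<lambda>n\<in>{1..}. truncation n a) \<in> top_iso seq_monoid (inverse_limit seq_monoid_upto truncation)"
proof -
  have upto_mem: "a \<in> carrier seq_monoid" if "a \<in> carrier (seq_monoid_upto n)" for a n
    using that seqs_upto_subset by (auto simp: seq_monoid_upto_eq)
  have lattice_upto: "top_comm_monoid (lattice_monoid_upto n)"  for n
    using top_comm_monoid_seq_upto slope_set_top_iso_upto by (rule top_comm_monoid_transport)
  have eta_iso: "eta \<in> top_iso seq_monoid lattice_monoid"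
    by (rule top_iso_cong[OF slope_set_top_iso top_comm_monoid_seq]) (rule eta_eq[symmetric])
  have eta_iso_upto: "eta \<in> top_iso (seq_monoid_upto n) (lattice_monoid_upto n)" for n
    by (rule top_iso_cong[OF slope_set_top_iso_upto top_comm_monoid_seq_upto])
      (rule eta_eq[OF upto_mem, symmetric])
  have commute: "eta (truncation n a) = rho n (eta a)" if "a \<in> carrier seq_monoid" for n a
    using eta_eq[OF that] eta_eq[OF truncation_in_carrier] rho_slope_set by simp
  have rho_rho: "rho n (rho (Suc n) L) = rho n L" if L: "L \<in> carrier lattice_monoid" for n L
  proof -
    obtain a where "L = slope_set a" using L ex_slope_set_of_lattice_set[of L] by auto
    then show ?thesis by (simp add: rho_slope_set truncation_truncation)
  qed
  show ?thesis
    unfolding surjective_inverse_system_def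
    using top_comm_monoid_seq top_comm_monoid_lattice top_comm_monoid_seq_upto lattice_upto
      truncation_top_epi truncation_top_epi_upto rho_top_epi rho_top_epi_upto eta_iso eta_iso_upto
      truncation_truncation[OF le_SucI[OF order_refl]] rho_rho commute upto_mem
      truncations_top_iso restrictions_top_iso
    by (intro conjI allI impI ballI) simp_all
qed

end
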